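(* Let $A^{(1)},\dots,A^{(k)}$ be zero diagonal real symmetric $n\times n$ matrices ($n,k\ge1$). Then $$\max_{i\in[k]}\lambda_{\max}\,\chi\left(A^{(i)}\right)\le k\,\lambda_{\max}\,\chi\left[A^{(1)},\dots,A^{(k)}\right].$$
   Context: $[n]=\{1,\dots,n\}$. For a matrix $A\in M_n(\mathbb{C})$, $\chi(A)(x)=\det(xI-A)$ is its characteristic polynomial, and for $S\subseteq[n]$, $A(S)$ is the principal submatrix of $A$ with rows and columns indexed by $S$ (the determinant of the empty matrix is $1$). For a $k$-tuple of matrices in $M_n(\mathbb{C})$, the mixed determinant is $$D[A^{(1)},\dots,A^{(k)}]=\sum_{S_1\amalg\cdots\amalg S_k=[n]}\det[A^{(1)}(S_1)]\cdots\det[A^{(k)}(S_k)],$$ the sum being over all ordered $k$-tuples of pairwise disjoint, possibly empty, subsets with union $[n]$. The mixed determinantal polynomial is $$\chi[A^{(1)},\dots,A^{(k)}](x)=k^{-n}D\left[xI-A^{(1)},\dots,xI-A^{(k)}\right].$$ It is real-rooted for Hermitian matrices. $\lambda_{\max}\,p$ denotes the largest root of a real-rooted polynomial $p$. *)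

theory Defs
  imports
    "HOL-Library.FuncSet"
    "HOL-Library.Disjoint_Sets"
    "Jordan_Normal_Form.Char_Poly"
    "Jordan_Normal_Form.DL_Submatrix"
begin

definition ordered_set_partitions :: "nat \<Rightarrow> 'a set \<Rightarrow> (nat \<Rightarrow> 'a set) set" where
  "ordered_set_partitions k X =
     {S \<in> {..<k} \<rightarrow>\<^sub>E Pow X. disjoint_family_on S {..<k} \<and> (\<Union>i<k. S i) = X}"

text \<open>Matrix indices and tuple positions start at 0. The empty principal submatrix is a
  0-by-0 matrix, whose determinant is 1.\<close>

definition mixed_det :: "nat \<Rightarrow> nat \<Rightarrow> (nat \<Rightarrow> 'a :: comm_ring_1 mat) \<Rightarrow> 'a" where
  "mixed_det n k A =
     (\<Sum>S \<in> ordered_set_partitions k {..<n}. \<Prod>i<k. det (submatrix (A i) (S i) (S i)))"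

text \<open>The mixed determinant is taken over the polynomial ring: \<^const>\<open>char_poly_matrix\<close> is
  the matrix xI - A with polynomial entries.\<close>

definition mixed_char_poly :: "nat \<Rightarrow> nat \<Rightarrow> (nat \<Rightarrow> 'a :: field_char_0 mat) \<Rightarrow> 'a poly" where
  "mixed_char_poly n k A =
     Polynomial.smult (inverse (of_nat k ^ n)) (mixed_det n k (\<lambda>i. char_poly_matrix (A i)))"

text \<open>Only meaningful for real polynomials with at least one real root, in particular
  for nonconstant real-rooted ones.\<close>

definition lambda_max :: "real poly \<Rightarrow> real" where
  "lambda_max p = Max {x. poly p x = 0}"

end

theory Submission
  imports Defs "HOL-Analysis.Convex" "HOL-Analysis.Elementary_Topology"
begin

text \<open>
  Fix \<open>j < k\<close>, write \<open>A = A j\<close>, let \<open>\<lambda>\<close> be the largest eigenvalue of \<open>A\<close>, and let \<open>b i\<close> be the set function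
  \<open>T \<mapsto> det (- A i (T))\<close>. A sum over ordered set partitions is an iterated subset convolution
  \<open>(a \<star> b) T = (\<Sum>U \<subseteq> T. a U * b (T - U))\<close>, and \<open>det ((x I - A i)(T))\<close> is the convolution of
  \<open>T \<mapsto> x ^ |T|\<close> with \<open>b i\<close>. Since convolution is commutative and associative, the rescaled mixed
  determinantal polynomial \<open>k ^ n * \<chi>[A 0, ..., A (k - 1)] (y / k)\<close> becomes \<open>Q y 1\<close>, where
  \<open>Q y s = ((T \<mapsto> y ^ |T|) \<star> b j \<star> (T \<mapsto> s ^ |T| * c T)) [n]\<close> and \<open>c\<close> is the convolution of the
  other \<open>b i\<close>. On the other hand \<open>Q y 0 = \<chi>(A) y\<close>. So the path \<open>s \<mapsto> Q y s\<close> joins the two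
  characteristic polynomials, and it suffices to find \<open>y \<ge> \<lambda>\<close> with \<open>Q y 1 \<le> 0\<close>.

  For \<open>y > \<lambda>\<close> the polynomial \<open>s \<mapsto> Q y s\<close> has only real roots (\<open>pencil_poly_real_rooted\<close>). This
  is a stability argument. The generating functions \<open>(\<Sum>T. a T * (\<Prod>i\<in>T. z i))\<close> of principal minors are
  determinants \<open>det (I + Z M)\<close> with \<open>M\<close> symmetric, which do not vanish on suitable half planes
  (\<open>nonvanishing_pminor\<close>), and convolution preserves nonvanishing (\<open>nonvanishing_conv\<close>).

  The zero diagonals give \<open>c {i} = 0\<close>, so the linear coefficient of \<open>s \<mapsto> Q y s\<close> is zero. A
  real-rooted polynomial that is positive on \<open>[0, 1]\<close> is log-concave there, so with a vanishing
  derivative at \<open>0\<close> it satisfies \<open>Q y 1 \<le> Q y 0\<close> (\<open>real_rooted_on_interval\<close>). If \<open>Q y 1\<close> were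
  positive for all \<open>y \<ge> \<lambda>\<close>, then \<open>Q\<close> would be positive on all of \<open>(\<lambda>, \<infinity>) \<times> [0, 1]\<close>: at a zero
  with the largest \<open>y\<close>, log-concavity on the segments above it bounds \<open>Q\<close> below by the positive
  values at the two ends of the segment. Then \<open>Q y 1 \<le> Q y 0\<close> for all \<open>y > \<lambda>\<close>, and letting \<open>y\<close>
  tend to \<open>\<lambda>\<close> gives \<open>Q \<lambda> 1 \<le> \<chi>(A) \<lambda> = 0\<close>, a contradiction.\<close>

section \<open>Convolution of set functions\<close>

text \<open>On the coefficients of multiaffine polynomials this is multiplication modulo the squares of the
variables.\<close>

definition conv :: "('i set \<Rightarrow> 'a) \<Rightarrow> ('i set \<Rightarrow> 'a) \<Rightarrow> 'i set \<Rightarrow> 'a :: comm_ring_1" where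
  "conv a b T = (\<Sum>U\<in>Pow T. a U * b (T - U))"

definition conv_unit :: "'i set \<Rightarrow> 'a :: comm_ring_1" where
  "conv_unit T = (if T = {} then 1 else 0)"

primrec conv_list :: "nat \<Rightarrow> (nat \<Rightarrow> 'i set \<Rightarrow> 'a) \<Rightarrow> 'i set \<Rightarrow> 'a :: comm_ring_1" where
  "conv_list 0 a = conv_unit"
| "conv_list (Suc k) a = conv (conv_list k a) (a k)"

lemma conv_infinite: "infinite T \<Longrightarrow> conv a b T = 0"
  by (simp add: conv_def)

lemma conv_commute: "conv a b = conv b a"
proof
  fix T
  show "conv a b T = conv b a T"
    unfolding conv_def
    by (rule sum.reindex_bij_witness[of _ "\<lambda>U. T - U" "\<lambda>U. T - U"])
       (auto simp: double_diff mult.commute)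
qed

lemma conv_assoc: "conv (conv a b) c = conv a (conv b c)"
proof
  fix T
  show "conv (conv a b) c T = conv a (conv b c) T"
  proof (cases "finite T")
    case True
    then have fin: "U \<subseteq> T \<Longrightarrow> finite U" for U using finite_subset by blast
    have "conv (conv a b) c T = (\<Sum>(W, U)\<in>Sigma (Pow T) Pow. a U * b (W - U) * c (T - W))"
      unfolding conv_def sum_distrib_right
      by (subst sum.Sigma) (use True fin in auto)
    also have "\<dots> = (\<Sum>(U, V)\<in>Sigma (Pow T) (\<lambda>U. Pow (T - U)). a U * (b V * c (T - U - V)))"
    proof (rule sum.reindex_bij_witness[of _ "\<lambda>(U, V). (U \<union> V, U)" "\<lambda>(W, U). (U, W - U)"])
      fix p assume "p \<in> Sigma (Pow T) Pow"
      then obtain W U where p: "p = (W, U)" "W \<subseteq> T" "U \<subseteq> W" by auto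
      then have "T - U - (W - U) = T - W" by auto
      with p show "(case case p of (W, U) \<Rightarrow> (U, W - U) of (U, V) \<Rightarrow> a U * (b V * c (T - U - V))) =
         (case p of (W, U) \<Rightarrow> a U * b (W - U) * c (T - W))"
        by (simp add: mult.assoc)
    qed auto
    also have "\<dots> = conv a (conv b c) T"
      unfolding conv_def sum_distrib_left
      by (subst sum.Sigma) (use True fin in auto)
    finally show ?thesis .
  qed (simp add: conv_infinite)
qed

lemma conv_left_commute: "conv a (conv b c) = conv b (conv a c)"
  by (metis conv_assoc conv_commute)

lemma conv_empty: "conv a b {} = a {} * b {}"
  by (simp add: conv_def)

lemma conv_singleton: "conv a b {i} = a {} * b {i} + a {i} * b {}"
proof -
  have "Pow {i} = {{}, {i}}" by auto
  then show ?thesis by (simp add: conv_def)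
qed

lemma conv_unit_left: "finite T \<Longrightarrow> conv conv_unit a T = a T"
proof -
  assume T: "finite T"
  have "conv conv_unit a T = (\<Sum>U\<in>Pow T. if U = {} then a T else 0)"
    unfolding conv_def by (rule sum.cong) (auto simp: conv_unit_def)
  also have "\<dots> = a T" using T by simp
  finally show ?thesis .
qed

lemma conv_cong:
  assumes "\<And>U. U \<subseteq> T \<Longrightarrow> a U = a' U" "\<And>U. U \<subseteq> T \<Longrightarrow> b U = b' U"
  shows "conv a b T = conv a' b' T"
  unfolding conv_def by (rule sum.cong) (use assms in auto)

lemma conv_list_empty: "conv_list k a {} = (\<Prod>i<k. a i {})"
  by (induction k) (simp_all add: conv_unit_def conv_empty)

lemma conv_list_cong:
  assumes "\<And>i. i < k \<Longrightarrow> a i = a' i"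
  shows "conv_list k a = conv_list k a'"
  using assms by (induction k) simp_all

text \<open>By commutativity any one factor can be moved to the front; the unit is left in its place, so that
the remaining factors keep their indices.\<close>

lemma conv_list_extract:
  assumes "j < k" "finite T"
  shows "conv_list k a T = conv (a j) (conv_list k (a(j := conv_unit))) T"
  using assms
proof (induction k arbitrary: T)
  case (Suc k)
  have fin: "U \<subseteq> T \<Longrightarrow> finite U" for U using Suc.prems finite_subset by blast
  show ?case
  proof (cases "j = k")
    case True
    have eq: "conv_list k (a(k := conv_unit)) = conv_list k a"
      by (rule conv_list_cong) auto
    have "conv (conv_list k a) conv_unit U = conv_list k a U" if "U \<subseteq> T" for U
      using conv_unit_left[OF fin[OF that]] by (metis conv_commute)
    then have "conv (a k) (conv (conv_list k a) conv_unit) T = conv (a k) (conv_list k a) T"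
      by (intro conv_cong) auto
    then show ?thesis unfolding True eq conv_list.simps fun_upd_same
      by (simp add: conv_commute[of "conv_list k a" "a k"])
  next
    case False
    have "conv_list (Suc k) a T
        = conv (conv (a j) (conv_list k (a(j := conv_unit)))) (a k) T"
      unfolding conv_list.simps using Suc False by (intro conv_cong fin Suc.IH) auto
    moreover have "(a(j := conv_unit)) k = a k" using False by simp
    ultimately show ?thesis unfolding conv_list.simps conv_assoc by simp
  qed
qed simp

lemma conv_list_mult:
  "conv_list k (\<lambda>i. conv (a i) (b i)) T = conv (conv_list k a) (conv_list k b) T"
  if "finite T"
  using that
proof (induction k arbitrary: T)
  case 0 then show ?case by (simp add: conv_unit_left)
next
  case (Suc k)
  have "conv_list (Suc k) (\<lambda>i. conv (a i) (b i)) T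
      = conv (conv (conv_list k a) (conv_list k b)) (conv (a k) (b k)) T"
    unfolding conv_list.simps by (intro conv_cong Suc.IH) (use Suc.prems finite_subset in auto)
  also have "\<dots> = conv (conv_list (Suc k) a) (conv_list (Suc k) b) T"
    by (simp add: conv_assoc conv_left_commute)
  finally show ?case .
qed

text \<open>Splitting off the last block of an ordered partition of \<open>X\<close> leaves an ordered partition of the
rest, which is the recursion that defines the iterated convolution.\<close>

lemma sum_ordered_set_partitions:
  assumes "finite X"
  shows "(\<Sum>S\<in>ordered_set_partitions k X. \<Prod>i<k. a i (S i)) = conv_list k a X"
  using assms
proof (induction k arbitrary: X)
  case 0
  have "ordered_set_partitions 0 X = (if X = {} then {\<lambda>_. undefined} else {})"
    by (auto simp: ordered_set_partitions_def disjoint_family_on_def)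
  then show ?case by (simp add: conv_unit_def)
next
  case (Suc k)
  have fin: "finite (ordered_set_partitions k U)" if "finite U" for U :: "'a set"
  proof (rule finite_subset)
    show "ordered_set_partitions k U \<subseteq> {..<k} \<rightarrow>\<^sub>E Pow U"
      by (auto simp: ordered_set_partitions_def)
    show "finite ({..<k} \<rightarrow>\<^sub>E Pow U)" using that by (intro finite_PiE) auto
  qed
  have finX: "finite U" if "U \<subseteq> X" for U using that Suc.prems finite_subset by blast
  have "(\<Sum>S\<in>ordered_set_partitions (Suc k) X. \<Prod>i<Suc k. a i (S i))
     = (\<Sum>(U, S)\<in>Sigma (Pow X) (ordered_set_partitions k). (\<Prod>i<k. a i (S i)) * a k (X - U))"
  proof (rule sum.reindex_bij_witness
      [of _ "\<lambda>(U, S). S(k := X - U)" "\<lambda>S. (X - S k, S(k := undefined))"])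
    fix S assume S: "S \<in> ordered_set_partitions (Suc k) X"
    then have S1: "S \<in> {..<Suc k} \<rightarrow>\<^sub>E Pow X" and S2: "disjoint_family_on S {..<Suc k}"
      and S3: "(\<Union>i<Suc k. S i) = X" by (auto simp: ordered_set_partitions_def)
    have Sk: "S k \<subseteq> X" using S3 by auto
    then show "(case (X - S k, S(k := undefined)) of (U, S) \<Rightarrow> S(k := X - U)) = S"
      by (auto simp: fun_eq_iff double_diff)
    have disj: "S i \<inter> S k = {}" if "i < k" for i
      using S2 that unfolding disjoint_family_on_def by auto
    have un: "(\<Union>i<k. S i) = X - S k"
      using S3 disj by (auto simp: lessThan_Suc)
    have "S(k := undefined) \<in> {..<k} \<rightarrow>\<^sub>E Pow (X - S k)"
      using S1 un by (auto simp: PiE_iff extensional_def)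
    moreover have "disjoint_family_on (S(k := undefined)) {..<k}"
      using S2 by (auto simp: disjoint_family_on_def)
    ultimately show "(X - S k, S(k := undefined)) \<in> Sigma (Pow X) (ordered_set_partitions k)"
      using un by (auto simp: ordered_set_partitions_def)
    show "(case (X - S k, S(k := undefined)) of (U, S) \<Rightarrow> (\<Prod>i<k. a i (S i)) * a k (X - U))
        = (\<Prod>i<Suc k. a i (S i))"
      using Sk by (simp add: double_diff)
  next
    fix p assume "p \<in> Sigma (Pow X) (ordered_set_partitions k)"
    then obtain U S where p: "p = (U, S)" and U: "U \<subseteq> X"
      and S1: "S \<in> {..<k} \<rightarrow>\<^sub>E Pow U" and S2: "disjoint_family_on S {..<k}"
      and S3: "(\<Union>i<k. S i) = U" by (auto simp: ordered_set_partitions_def)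
    have Sk: "S k = undefined" using S1 by (auto simp: PiE_iff extensional_def)
    show "(X - (case p of (U, S) \<Rightarrow> S(k := X - U)) k,
           (case p of (U, S) \<Rightarrow> S(k := X - U))(k := undefined)) = p"
      using U Sk by (auto simp: p fun_eq_iff double_diff)
    have "S(k := X - U) \<in> {..<Suc k} \<rightarrow>\<^sub>E Pow X"
      using S1 U by (fastforce simp: PiE_iff extensional_def less_Suc_eq)
    moreover have "disjoint_family_on (S(k := X - U)) {..<Suc k}"
    proof -
      have "disjoint_family_on (S(k := X - U)) {..<k}"
        using S2 by (simp add: disjoint_family_on_def)
      moreover have "(X - U) \<inter> (\<Union>i<k. (S(k := X - U)) i) = {}"
        using S3 by auto
      ultimately show ?thesis
        by (simp add: lessThan_Suc disjoint_family_on_insert)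
    qed
    moreover have "(\<Union>i<Suc k. (S(k := X - U)) i) = X"
      using S3 U by (auto simp: lessThan_Suc)
    ultimately show "(case p of (U, S) \<Rightarrow> S(k := X - U)) \<in> ordered_set_partitions (Suc k) X"
      unfolding p ordered_set_partitions_def by simp
  qed
  also have "\<dots> = (\<Sum>U\<in>Pow X. conv_list k a U * a k (X - U))"
  proof -
    have "(\<Sum>(U, S)\<in>Sigma (Pow X) (ordered_set_partitions k). (\<Prod>i<k. a i (S i)) * a k (X - U))
      = (\<Sum>U\<in>Pow X. \<Sum>S\<in>ordered_set_partitions k U. (\<Prod>i<k. a i (S i)) * a k (X - U))"
      by (rule sum.Sigma[symmetric]) (use Suc.prems fin finX in auto)
    also have "\<dots> = (\<Sum>U\<in>Pow X. conv_list k a U * a k (X - U))"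
      by (rule sum.cong) (use Suc.IH finX in \<open>auto simp: sum_distrib_right[symmetric]\<close>)
    finally show ?thesis .
  qed
  also have "\<dots> = conv_list (Suc k) a X" by (simp add: conv_def)
  finally show ?case .
qed

text \<open>The binomial theorem makes these set functions an additive one-parameter family under
convolution. It is this that lets the \<open>k\<close> copies of \<open>x I\<close> in the mixed determinant be
redistributed freely among the factors.\<close>

definition pow_card :: "'a \<Rightarrow> 'i set \<Rightarrow> 'a :: comm_ring_1" where
  "pow_card x T = x ^ card T"

lemma conv_pow_card:
  assumes "finite T"
  shows "conv (pow_card x) (pow_card y) T = pow_card (x + y) T"
proof -
  have "(\<Prod>i\<in>T. x + y) = conv (pow_card x) (pow_card y) T"
    unfolding conv_def pow_card_def by (subst prod_add[OF assms]) simp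
  then show ?thesis by (simp add: pow_card_def)
qed

lemma conv_list_pow_card:
  assumes "finite T"
  shows "conv_list k (\<lambda>_. pow_card x) T = pow_card (of_nat k * x) T"
  using assms
proof (induction k arbitrary: T)
  case 0
  then show ?case by (auto simp: conv_unit_def pow_card_def power_0_left)
next
  case (Suc k)
  have "conv_list (Suc k) (\<lambda>_. pow_card x) T = conv (pow_card (of_nat k * x)) (pow_card x) T"
    unfolding conv_list.simps by (intro conv_cong Suc.IH) (use Suc.prems finite_subset in auto)
  then show ?case using Suc.prems by (simp add: conv_pow_card algebra_simps)
qed

section \<open>Principal minors\<close>

text \<open>The Leibniz formula with rows and columns indexed by \<open>T\<close> itself, which avoids the renumbering of
rows and columns in a submatrix.\<close>

definition pminor :: "(nat \<Rightarrow> nat \<Rightarrow> 'a) \<Rightarrow> nat set \<Rightarrow> 'a :: comm_ring_1" where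
  "pminor M T = (\<Sum>p | p permutes T. of_int (sign p) * (\<Prod>i\<in>T. M i (p i)))"

lemma pminor_empty [simp]: "pminor M {} = 1"
  by (simp add: pminor_def)

lemma pminor_singleton: "pminor M {i} = M i i"
  by (simp add: pminor_def)

lemma pminor_cong:
  assumes "\<And>i j. i \<in> T \<Longrightarrow> j \<in> T \<Longrightarrow> M i j = M' i j"
  shows "pminor M T = pminor M' T"
  unfolding pminor_def
  by (rule sum.cong) (use assms in \<open>auto intro!: arg_cong2[of _ _ _ _ "(*)"] prod.cong simp: permutes_in_image\<close>)

lemma pminor_row_scale: "pminor (\<lambda>i j. z i * M i j) T = (\<Prod>i\<in>T. z i) * pminor M T"
  by (simp add: pminor_def prod.distrib sum_distrib_left algebra_simps)

text \<open>Used for evaluation of polynomials and for the embedding of the reals into the complex numbers.\<close>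

lemma pminor_hom:
  assumes "\<And>x y. h (x + y) = h x + h y" "\<And>x y. h (x * y) = h x * h y" "h 0 = 0" "h 1 = 1" 
  shows "h (pminor M T) = pminor (\<lambda>i j. h (M i j)) T"
proof -
  have s: "h (sum f A) = (\<Sum>x\<in>A. h (f x))" for f and A :: "(nat \<Rightarrow> nat) set"
    using assms(1,3) by (induction A rule: infinite_finite_induct) auto
  have p: "h (prod f A) = (\<Prod>x\<in>A. h (f x))" for f and A :: "nat set"
    using assms(2,4) by (induction A rule: infinite_finite_induct) auto
  have "h (-1) + h 1 = h 0" by (simp flip: assms(1))
  then have "h (-1) = -1" using assms(3,4) by (simp add: eq_neg_iff_add_eq_0)
  then have "h (of_int (sign q)) = of_int (sign q)" for q :: "nat \<Rightarrow> nat"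
    by (cases q rule: sign_cases) (simp_all add: assms)
  then show ?thesis by (simp add: pminor_def s p assms)
qed

text \<open>Expanding each product of the Leibniz formula, a choice of \<open>T\<close> for the rows that contribute \<open>B\<close>
survives exactly when the permutation fixes the other rows, that is, permutes \<open>T\<close>.\<close>

lemma pminor_add_diag:
  assumes X: "finite X"
  shows "pminor (\<lambda>i j. (if i = j then d i else 0) + B i j) X
       = (\<Sum>T\<in>Pow X. (\<Prod>i\<in>X - T. d i) * pminor B T)"
proof -
  have perm: "(\<Prod>i\<in>X - T. if i = p i then d i else 0)
      = (if p permutes T then \<Prod>i\<in>X - T. d i else 0)"
    if p: "p permutes X" and T: "T \<subseteq> X" for p T
  proof (cases "p permutes T")
    case True
    then show ?thesis by (auto intro!: prod.cong dest: permutes_not_in)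
  next
    case False
    then obtain i where "i \<in> X - T" "p i \<noteq> i"
      using permutes_superset[OF p, of T] by blast
    then show ?thesis using X False by (auto intro!: prod_zero bexI[of _ i])
  qed
  have "pminor (\<lambda>i j. (if i = j then d i else 0) + B i j) X
     = (\<Sum>p | p permutes X. of_int (sign p) *
          (\<Sum>T\<in>Pow X. (\<Prod>i\<in>T. B i (p i)) * (\<Prod>i\<in>X - T. if i = p i then d i else 0)))"
    unfolding pminor_def by (subst add.commute, subst prod_add[OF X]) simp
  also have "\<dots> = (\<Sum>T\<in>Pow X. \<Sum>p | p permutes X. of_int (sign p) *
          ((\<Prod>i\<in>T. B i (p i)) * (\<Prod>i\<in>X - T. if i = p i then d i else 0)))"
    unfolding sum_distrib_left by (rule sum.swap)
  also have "\<dots> = (\<Sum>T\<in>Pow X. (\<Prod>i\<in>X - T. d i) * pminor B T)"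
  proof (rule sum.cong[OF refl])
    fix T assume "T \<in> Pow X"
    then have T: "T \<subseteq> X" by simp
    have "(\<Sum>p | p permutes X. of_int (sign p) *
          ((\<Prod>i\<in>T. B i (p i)) * (\<Prod>i\<in>X - T. if i = p i then d i else 0)))
        = (\<Sum>p | p permutes X. if p permutes T then
             of_int (sign p) * ((\<Prod>i\<in>T. B i (p i)) * (\<Prod>i\<in>X - T. d i)) else 0)"
      by (rule sum.cong) (use perm T in auto)
    also have "\<dots> = (\<Sum>p\<in>{p. p permutes X} \<inter> {p. p permutes T}.
             of_int (sign p) * ((\<Prod>i\<in>T. B i (p i)) * (\<Prod>i\<in>X - T. d i)))"
      using X by (subst sum.inter_restrict) (auto simp: finite_permutations)
    also have "{p. p permutes X} \<inter> {p. p permutes T} = {p. p permutes T}"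
      using T permutes_subset by blast
    finally show "(\<Sum>p | p permutes X. of_int (sign p) *
          ((\<Prod>i\<in>T. B i (p i)) * (\<Prod>i\<in>X - T. if i = p i then d i else 0)))
        = (\<Prod>i\<in>X - T. d i) * pminor B T"
      by (simp add: pminor_def sum_distrib_left algebra_simps)
  qed
  finally show ?thesis .
qed

lemma pminor_shift:
  assumes "finite T"
  shows "pminor (\<lambda>i j. (if i = j then x else 0) + B i j) T = conv (pow_card x) (pminor B) T"
proof -
  have "pminor (\<lambda>i j. (if i = j then x else 0) + B i j) T = conv (pminor B) (pow_card x) T"
    unfolding pminor_add_diag[OF assms] by (simp add: conv_def pow_card_def mult.commute)
  then show ?thesis by (simp add: conv_commute)
qed

lemma pminor_reindex:
  assumes f: "bij_betw f S T" and S: "finite S"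
  shows "pminor (\<lambda>i j. M (f i) (f j)) S = pminor M T"
proof -
  have inj: "inj_on f S" and T: "T = f ` S" using f by (auto simp: bij_betw_def)
  show ?thesis
    unfolding pminor_def
  proof (rule sum.reindex_bij_witness[of _ "map_permutation T (inv_into S f)" "map_permutation S f"])
    fix p assume "p \<in> {p. p permutes S}"
    then have p: "p permutes S" by simp
    show "map_permutation S f p \<in> {p. p permutes T}"
      using map_permutation_permutes[OF f p] by simp
    show "map_permutation T (inv_into S f) (map_permutation S f p) = p"
      using map_permutation_compose_inv[OF f p] inj by (simp add: inj_on_inv_into)
    have sg: "sign (map_permutation S f p) = sign p"
      by (rule sign_map_permutation) (use inj p S in auto)
    have "(\<Prod>i\<in>T. M i (map_permutation S f p i)) = (\<Prod>i\<in>S. M (f i) (map_permutation S f p (f i)))"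
      using prod.reindex[OF inj, of "\<lambda>i. M i (map_permutation S f p i)"] T by simp
    also have "\<dots> = (\<Prod>i\<in>S. M (f i) (f (p i)))"
      by (rule prod.cong) (auto simp: map_permutation_apply inj)
    finally show "of_int (sign (map_permutation S f p)) * (\<Prod>i\<in>T. M i (map_permutation S f p i))
        = of_int (sign p) * (\<Prod>i\<in>S. M (f i) (f (p i)))" by (simp add: sg)
  next
    fix p assume "p \<in> {p. p permutes T}"
    then have p: "p permutes T" by simp
    have f': "bij_betw (inv_into S f) T S" using f by (rule bij_betw_inv_into)
    show "map_permutation T (inv_into S f) p \<in> {p. p permutes S}"
      using map_permutation_permutes[OF f' p] by simp
    show "map_permutation S f (map_permutation T (inv_into S f) p) = p"
      by (rule map_permutation_compose_inv[OF f' p]) (use T in \<open>auto simp: f_inv_into_f\<close>)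
  qed
qed

lemma det_eq_pminor:
  assumes "A \<in> carrier_mat n n"
  shows "det A = pminor (\<lambda>i j. A $$ (i, j)) {..<n}"
  unfolding det_def'[OF assms] pminor_def by (simp add: atLeast0LessThan)

lemma det_submatrix:
  assumes A: "A \<in> carrier_mat n n" and S: "S \<subseteq> {..<n}"
  shows "det (submatrix A S S) = pminor (\<lambda>i j. A $$ (i, j)) S"
proof -
  have fS: "finite S" using S finite_subset by blast
  have eq: "{i. i < n \<and> i \<in> S} = S" using S by auto
  have sub: "submatrix A S S = mat (card S) (card S) (\<lambda>(i, j). A $$ (pick S i, pick S j))"
    using A by (simp add: submatrix_def eq)
  have inj: "inj_on (pick S) {..<card S}"
    by (rule inj_onI) (metis card_pick lessThan_iff)
  have "pick S ` {..<card S} \<subseteq> S" using pick_in_set_le by auto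
  then have "pick S ` {..<card S} = S"
    using card_subset_eq[OF fS] card_image[OF inj] by simp
  then have bij: "bij_betw (pick S) {..<card S} S" using inj by (simp add: bij_betw_def)
  have "det (submatrix A S S)
      = pminor (\<lambda>i j. submatrix A S S $$ (i, j)) {..<card S}"
    by (rule det_eq_pminor) (simp add: sub)
  also have "\<dots> = pminor (\<lambda>i j. A $$ (pick S i, pick S j)) {..<card S}"
    by (rule pminor_cong) (simp add: sub)
  also have "\<dots> = pminor (\<lambda>i j. A $$ (i, j)) S"
    by (rule pminor_reindex[OF bij]) simp
  finally show ?thesis .
qed

lemma poly_pminor_char_poly_matrix:
  fixes A :: "'a :: comm_ring_1 mat"
  assumes A: "A \<in> carrier_mat n n" and T: "T \<subseteq> {..<n}"
  shows "poly (pminor (\<lambda>i j. char_poly_matrix A $$ (i, j)) T) x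
       = conv (pow_card x) (pminor (\<lambda>i j. - A $$ (i, j))) T"
proof -
  have "poly (pminor (\<lambda>i j. char_poly_matrix A $$ (i, j)) T) x
      = pminor (\<lambda>i j. poly (char_poly_matrix A $$ (i, j)) x) T"
    by (rule pminor_hom) auto
  also have "\<dots> = pminor (\<lambda>i j. (if i = j then x else 0) + - A $$ (i, j)) T"
    by (rule pminor_cong) (use A T in \<open>auto simp: char_poly_matrix_def subset_eq\<close>)
  finally show ?thesis using T finite_subset by (subst (asm) pminor_shift) auto
qed

lemma poly_char_poly:
  fixes A :: "'a :: comm_ring_1 mat"
  assumes A: "A \<in> carrier_mat n n"
  shows "poly (char_poly A) x = conv (pow_card x) (pminor (\<lambda>i j. - A $$ (i, j))) {..<n}"
proof -
  have "char_poly A = pminor (\<lambda>i j. char_poly_matrix A $$ (i, j)) {..<n}"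
    unfolding char_poly_def by (rule det_eq_pminor) (use A in simp)
  then show ?thesis by (simp add: poly_pminor_char_poly_matrix[OF A])
qed

text \<open>Each factor \<open>det ((x I - A i)(S))\<close> is a convolution with \<open>pow_card x\<close>; collecting these \<open>k\<close>
factors gives \<open>pow_card (k * x)\<close>.\<close>

lemma poly_mixed_char_poly:
  fixes A :: "nat \<Rightarrow> 'a :: field_char_0 mat"
  assumes A: "\<And>i. i < k \<Longrightarrow> A i \<in> carrier_mat n n" and k: "k > 0"
  shows "of_nat k ^ n * poly (mixed_char_poly n k A) x
    = conv (pow_card (of_nat k * x)) (conv_list k (\<lambda>i. pminor (\<lambda>r c. - A i $$ (r, c)))) {..<n}"
proof -
  let ?b = "\<lambda>i. pminor (\<lambda>r c. - A i $$ (r, c))"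
  have "poly (mixed_det n k (\<lambda>i. char_poly_matrix (A i))) x
      = (\<Sum>S\<in>ordered_set_partitions k {..<n}. \<Prod>i<k. conv (pow_card x) (?b i) (S i))"
    unfolding mixed_det_def poly_sum poly_prod
  proof (intro sum.cong prod.cong refl)
    fix S i assume "S \<in> ordered_set_partitions k {..<n}" and i: "i \<in> {..<k}"
    then have S: "S i \<subseteq> {..<n}" by (auto simp: ordered_set_partitions_def PiE_iff)
    show "poly (det (submatrix (char_poly_matrix (A i)) (S i) (S i))) x
        = conv (pow_card x) (?b i) (S i)"
      using det_submatrix[OF _ S, of "char_poly_matrix (A i)"] poly_pminor_char_poly_matrix[OF A S] i
      by (simp add: A)
  qed
  also have "\<dots> = conv (conv_list k (\<lambda>_. pow_card x)) (conv_list k ?b) {..<n}"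
    by (subst sum_ordered_set_partitions) (simp_all add: conv_list_mult)
  also have "\<dots> = conv (pow_card (of_nat k * x)) (conv_list k ?b) {..<n}"
    by (intro conv_cong conv_list_pow_card) (auto intro: finite_subset)
  finally show ?thesis using k by (simp add: mixed_char_poly_def field_simps)
qed

section \<open>Nonvanishing generating functions\<close>

definition genfun :: "nat \<Rightarrow> (nat set \<Rightarrow> complex) \<Rightarrow> (nat \<Rightarrow> complex) \<Rightarrow> complex" where
  "genfun n a z = (\<Sum>T\<in>Pow {..<n}. a T * (\<Prod>i\<in>T. z i))"

text \<open>The half plane \<open>Im (\<omega> * z) > 0\<close> is open with the origin on its boundary. The origin itself is
admitted as a value of each variable, so that variables can be set to zero without a limit
argument. For \<open>\<omega> = 1\<close> this is stability in the usual sense, up to the boundary point.\<close>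

definition nonvanishing :: "nat \<Rightarrow> complex \<Rightarrow> (nat set \<Rightarrow> complex) \<Rightarrow> bool" where
  "nonvanishing n \<omega> a \<longleftrightarrow>
     (\<forall>z. (\<forall>i<n. z i = 0 \<or> Im (\<omega> * z i) > 0) \<longrightarrow> genfun n a z \<noteq> 0)"

text \<open>Passing to reciprocals turns the half plane into the half plane of all \<open>u\<close> with
\<open>Im (\<omega> * cnj u) > 0\<close>, and the quadratic into \<open>\<alpha> u\<^sup>2 + \<beta> u + \<delta>\<close>, whose roots have sum
\<open>- \<beta> / \<alpha>\<close>. A zero \<open>\<zeta>\<close> of the truncation has \<open>1 / \<zeta> = - \<beta> / \<alpha>\<close>, and a sum of two numbers lies
in an open half plane through the origin only if one of them does.\<close>

lemma truncate_quadratic_nonvanishing: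
  fixes \<alpha> \<beta> \<delta> \<zeta> \<omega> :: complex
  assumes nz: "\<And>x. x = 0 \<or> Im (\<omega> * x) > 0 \<Longrightarrow> \<alpha> + \<beta> * x + \<delta> * x\<^sup>2 \<noteq> 0"
    and \<zeta>: "\<zeta> = 0 \<or> Im (\<omega> * \<zeta>) > 0"
  shows "\<alpha> + \<beta> * \<zeta> \<noteq> 0"
proof
  assume eq: "\<alpha> + \<beta> * \<zeta> = 0"
  have \<alpha>: "\<alpha> \<noteq> 0" using nz[of 0] by simp
  with eq have \<zeta>0: "\<zeta> \<noteq> 0" by auto
  define s where "s = csqrt (\<beta>\<^sup>2 - 4 * \<alpha> * \<delta>)"
  define u1 where "u1 = (- \<beta> + s) / (2 * \<alpha>)"
  define u2 where "u2 = (- \<beta> - s) / (2 * \<alpha>)"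
  have s2: "s\<^sup>2 = \<beta>\<^sup>2 - 4 * \<alpha> * \<delta>" by (simp add: s_def)
  have root: "\<alpha> * u\<^sup>2 + \<beta> * u + \<delta> = 0" if "u = u1 \<or> u = u2" for u
  proof -
    have "4 * \<alpha> * (\<alpha> * u\<^sup>2 + \<beta> * u + \<delta>) = (2 * \<alpha> * u + \<beta>)\<^sup>2 - s\<^sup>2"
      unfolding s2 by (simp add: power2_eq_square algebra_simps)
    also have "\<dots> = 0" using that \<alpha> by (auto simp: u1_def u2_def)
    finally show ?thesis using \<alpha> by simp
  qed
  have "u1 + u2 = - \<beta> / \<alpha>"
    using \<alpha> by (simp add: u1_def u2_def field_simps)
  also have "\<dots> = 1 / \<zeta>"
    using eq \<alpha> \<zeta>0 by (simp add: field_simps add_eq_0_iff)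
  finally have sum: "u1 + u2 = 1 / \<zeta>" .
  have conj: "Im (\<omega> * cnj (1 / x)) = Im (\<omega> * x) / (cmod x)\<^sup>2" if "x \<noteq> 0" for x
  proof -
    have "\<omega> * cnj (1 / x) = \<omega> * x / of_real ((cmod x)\<^sup>2)"
      unfolding complex_norm_square using that by (simp add: field_simps)
    then show ?thesis by (metis Im_divide_of_real)
  qed
  have "Im (\<omega> * cnj (1 / \<zeta>)) > 0"
    using \<zeta> \<zeta>0 by (subst conj) auto
  then have "Im (\<omega> * cnj u1) + Im (\<omega> * cnj u2) > 0"
    unfolding sum[symmetric] by (simp add: algebra_simps)
  then obtain u where u: "u = u1 \<or> u = u2" "Im (\<omega> * cnj u) > 0"
    by (metis add_nonpos_nonpos not_le)
  then have u0: "u \<noteq> 0" by auto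
  have "\<alpha> + \<beta> * (1 / u) + \<delta> * (1 / u)\<^sup>2 = (\<alpha> * u\<^sup>2 + \<beta> * u + \<delta>) / u\<^sup>2"
    using u0 by (simp add: field_simps power2_eq_square)
  then have "\<alpha> + \<beta> * (1 / u) + \<delta> * (1 / u)\<^sup>2 = 0" using root u by simp
  moreover have "Im (\<omega> * (1 / u)) > 0"
  proof -
    have "Im (\<omega> * cnj u) = Im (\<omega> * (1 / u)) / (cmod (1 / u))\<^sup>2"
      using conj[of "1 / u"] u0 by simp
    then show ?thesis using u u0 by (simp add: zero_less_divide_iff zero_less_mult_iff)
  qed
  ultimately show False using nz by blast
qed

text \<open>Start from the product of the two generating functions and discard the squares of the variables
one variable at a time. As a function of a single variable the current polynomial is quadratic,
so each step is an instance of the previous lemma.\<close>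

lemma nonvanishing_conv:
  assumes a: "nonvanishing n \<omega> a" and b: "nonvanishing n \<omega> b"
  shows "nonvanishing n \<omega> (conv a b)"
proof -
  let ?P = "Pow {..<n} \<times> Pow {..<n} :: (nat set \<times> nat set) set"
  \<comment> \<open>The product after the squares of the first \<open>m\<close> variables have been discarded.\<close>
  define G where "G m z = (\<Sum>p | p \<in> ?P \<and> fst p \<inter> snd p \<inter> {..<m} = {}.
      a (fst p) * b (snd p) * ((\<Prod>i\<in>fst p. z i) * (\<Prod>i\<in>snd p. z i)))" for m z
  have finP: "finite ?P" by simp
  have G: "G m z \<noteq> 0" if "m \<le> n" "\<And>i. i < n \<Longrightarrow> z i = 0 \<or> Im (\<omega> * z i) > 0" for m z
    using that
  proof (induction m arbitrary: z)
    case 0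
    have "G 0 z = genfun n a z * genfun n b z"
      unfolding G_def genfun_def sum_product sum.cartesian_product
      by (intro sum.cong) (auto simp: algebra_simps)
    then show ?case using a b 0 by (simp add: nonvanishing_def)
  next
    case (Suc m)
    \<comment> \<open>\<open>e p\<close> is the exponent of the variable \<open>z m\<close> in the monomial of the pair \<open>p\<close>, and \<open>K p\<close>
      is the remaining factor.\<close>
    define e where "e p = (if m \<in> fst p then 1 else 0) + (if m \<in> snd p then 1 else 0 :: nat)"
      for p :: "nat set \<times> nat set"
    define K where "K p = a (fst p) * b (snd p) *
      ((\<Prod>i\<in>fst p - {m}. z i) * (\<Prod>i\<in>snd p - {m}. z i))" for p
    define I where "I = {p. p \<in> ?P \<and> fst p \<inter> snd p \<inter> {..<m} = {}}"
    have finI: "finite I" unfolding I_def by (rule finite_subset[OF _ finP]) auto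
    have fin: "finite S" if "p \<in> ?P" "S = fst p \<or> S = snd p" for p S
      using that finite_subset[of S "{..<n}"] by auto
    have pr: "(\<Prod>i\<in>S. (z(m := x)) i) = (if m \<in> S then x else 1) * (\<Prod>i\<in>S - {m}. z i)"
      if "finite S" for S x
    proof -
      have "(\<Prod>i\<in>S - {m}. (z(m := x)) i) = (\<Prod>i\<in>S - {m}. z i)" by (rule prod.cong) auto
      moreover have "(\<Prod>i\<in>S. (z(m := x)) i) = (if m \<in> S then x else 1) * (\<Prod>i\<in>S - {m}. (z(m := x)) i)"
        using that prod.remove[of S m "z(m := x)"] by (cases "m \<in> S") auto
      ultimately show ?thesis by simp
    qed
    have summand: "a (fst p) * b (snd p) * ((\<Prod>i\<in>fst p. (z(m := x)) i) * (\<Prod>i\<in>snd p. (z(m := x)) i))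
        = K p * x ^ e p" if "p \<in> ?P" for p x
      unfolding pr[OF fin[OF that disjI1[OF refl]]] pr[OF fin[OF that disjI2[OF refl]]]
      by (auto simp: K_def e_def)
    have e: "e p = 0 \<or> e p = 1 \<or> e p = 2" for p by (auto simp: e_def)
    define C where "C d = (\<Sum>p\<in>I. if e p = d then K p else 0)" for d
    have Gm: "G m (z(m := x)) = C 0 + C 1 * x + C 2 * x\<^sup>2" for x
    proof -
      have "G m (z(m := x)) = (\<Sum>p\<in>I. K p * x ^ e p)"
        unfolding G_def I_def by (rule sum.cong) (use summand in auto)
      also have "\<dots> = (\<Sum>p\<in>I. (if e p = 0 then K p else 0) + (if e p = 1 then K p else 0) * x
          + (if e p = 2 then K p else 0) * x\<^sup>2)"
        by (rule sum.cong[OF refl]) (use e in force)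
      finally show ?thesis by (simp add: C_def sum.distrib sum_distrib_right)
    qed
    note summand' = summand[where x = "z m", unfolded fun_upd_triv]
    have "G (Suc m) z = (\<Sum>p\<in>I \<inter> {p. \<not> (m \<in> fst p \<and> m \<in> snd p)}. K p * z m ^ e p)"
      unfolding G_def
      by (rule sum.cong) (auto simp: I_def lessThan_Suc summand'[simplified])
    also have "\<dots> = (\<Sum>p\<in>I. if \<not> (m \<in> fst p \<and> m \<in> snd p) then K p * z m ^ e p else 0)"
      using finI by (subst sum.inter_restrict) auto
    also have "\<dots> = (\<Sum>p\<in>I. (if e p = 0 then K p else 0) + (if e p = 1 then K p else 0) * z m)"
      by (rule sum.cong) (auto simp: e_def)
    finally have GS: "G (Suc m) z = C 0 + C 1 * z m"
      by (simp add: C_def sum.distrib sum_distrib_right)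
    show ?case unfolding GS
    proof (rule truncate_quadratic_nonvanishing)
      fix x assume "x = 0 \<or> Im (\<omega> * x) > 0"
      then have "G m (z(m := x)) \<noteq> 0" using Suc by (intro Suc.IH) auto
      then show "C 0 + C 1 * x + C 2 * x\<^sup>2 \<noteq> 0" by (simp add: Gm)
    qed (use Suc.prems in auto)
  qed
  have Gn: "G n z = genfun n (conv a b) z" for z
  proof -
    have fin: "S \<subseteq> {..<n} \<Longrightarrow> finite S" for S :: "nat set" using finite_subset by blast
    have "G n z = (\<Sum>(T, U)\<in>Sigma (Pow {..<n}) Pow. a U * b (T - U) * (\<Prod>i\<in>T. z i))"
      unfolding G_def
    proof (rule sum.reindex_bij_witness[of _ "\<lambda>(T, U). (U, T - U)" "\<lambda>(U, V). (U \<union> V, U)"])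
      fix p assume p: "p \<in> {p \<in> ?P. fst p \<inter> snd p \<inter> {..<n} = {}}"
      obtain U V where UV: "p = (U, V)" by (cases p)
      have d: "U \<inter> V = {}" and sub: "U \<subseteq> {..<n}" "V \<subseteq> {..<n}" using p UV by auto
      then have "U \<union> V - U = V" by auto
      then show "(case (case p of (U, V) \<Rightarrow> (U \<union> V, U)) of (T, U) \<Rightarrow> (U, T - U)) = p"
        and "(case (case p of (U, V) \<Rightarrow> (U \<union> V, U)) of
               (T, U) \<Rightarrow> a U * b (T - U) * (\<Prod>i\<in>T. z i)) =
             a (fst p) * b (snd p) * ((\<Prod>i\<in>fst p. z i) * (\<Prod>i\<in>snd p. z i))"
        using UV d sub fin by (auto simp: prod.union_disjoint)
      show "(case p of (U, V) \<Rightarrow> (U \<union> V, U)) \<in> Sigma (Pow {..<n}) Pow"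
        using UV sub by auto
    qed auto
    also have "\<dots> = (\<Sum>T\<in>Pow {..<n}. \<Sum>U\<in>Pow T. a U * b (T - U) * (\<Prod>i\<in>T. z i))"
      by (rule sum.Sigma[symmetric]) (use fin in auto)
    finally show ?thesis by (simp add: genfun_def conv_def sum_distrib_right)
  qed
  show ?thesis
    unfolding nonvanishing_def using G[of n] by (simp add: Gn)
qed

lemma nonvanishing_conv_unit: "nonvanishing n \<omega> conv_unit"
proof -
  have "genfun n conv_unit z = (\<Sum>T\<in>Pow {..<n}. if T = {} then 1 else 0)" for z
    unfolding genfun_def by (rule sum.cong) (auto simp: conv_unit_def)
  then show ?thesis by (simp add: nonvanishing_def)
qed

lemma nonvanishing_conv_list:
  assumes "\<And>i. i < k \<Longrightarrow> nonvanishing n \<omega> (a i)"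
  shows "nonvanishing n \<omega> (conv_list k a)"
  using assms by (induction k) (simp_all add: nonvanishing_conv_unit nonvanishing_conv)

text \<open>Multiplying all variables by \<open>s\<close> rotates the upper half plane into the half plane of \<open>s\<close>.\<close>

lemma nonvanishing_scale:
  assumes "nonvanishing n 1 a"
  shows "nonvanishing n s (\<lambda>T. s ^ card T * a T)"
proof -
  have "genfun n (\<lambda>T. s ^ card T * a T) z = genfun n a (\<lambda>i. s * z i)" for z
    by (simp add: genfun_def prod.distrib algebra_simps)
  then show ?thesis using assms by (auto simp: nonvanishing_def)
qed

section \<open>Symmetric matrices\<close>

lemma det_zero_kernel:
  fixes M :: "nat \<Rightarrow> nat \<Rightarrow> 'a :: field"
  assumes "pminor M {..<n} = 0"
  obtains v i where "i < n" "v i \<noteq> 0" "\<And>r. r < n \<Longrightarrow> (\<Sum>j<n. M r j * v j) = 0"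
proof -
  let ?A = "mat n n (\<lambda>(i, j). M i j)"
  have "det ?A = pminor (\<lambda>i j. ?A $$ (i, j)) {..<n}" by (rule det_eq_pminor) simp
  also have "\<dots> = pminor M {..<n}" by (rule pminor_cong) auto
  finally have "det ?A = 0" using assms by simp
  then obtain v where v: "v \<in> carrier_vec n" "v \<noteq> 0\<^sub>v n" "?A *\<^sub>v v = 0\<^sub>v n"
    using det_0_iff_vec_prod_zero_field[of ?A n] by auto
  then obtain i where i: "i < n" "v $ i \<noteq> 0"
    by (metis carrier_vecD eq_vecI index_zero_vec(1,2))
  show ?thesis
  proof (rule that[of i "\<lambda>j. v $ j"])
    fix r assume r: "r < n"
    then have "(?A *\<^sub>v v) $ r = (\<Sum>j<n. M r j * v $ j)"
      using v(1) by (simp add: scalar_prod_def atLeast0LessThan)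
    then show "(\<Sum>j<n. M r j * v $ j) = 0" using v(3) r by simp
  qed (use i in auto)
qed

definition quad :: "nat \<Rightarrow> (nat \<Rightarrow> nat \<Rightarrow> real) \<Rightarrow> (nat \<Rightarrow> real) \<Rightarrow> real" where
  "quad n M v = (\<Sum>i<n. \<Sum>j<n. M i j * v i * v j)"

text \<open>The cross terms of real and imaginary parts cancel by symmetry.\<close>

lemma hermitian_form_of_real_symmetric:
  fixes M :: "nat \<Rightarrow> nat \<Rightarrow> real"
  assumes sym: "\<And>i j. i < n \<Longrightarrow> j < n \<Longrightarrow> M i j = M j i"
  shows "(\<Sum>i<n. \<Sum>j<n. of_real (M i j) * cnj (v i) * v j)
       = of_real (quad n M (\<lambda>i. Re (v i)) + quad n M (\<lambda>i. Im (v i)))"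
proof (rule complex_eqI)
  show "Re (\<Sum>i<n. \<Sum>j<n. of_real (M i j) * cnj (v i) * v j)
      = Re (of_real (quad n M (\<lambda>i. Re (v i)) + quad n M (\<lambda>i. Im (v i))))"
    by (simp add: quad_def sum.distrib[symmetric] algebra_simps)
  have "(\<Sum>i<n. \<Sum>j<n. M i j * (Re (v i) * Im (v j))) = (\<Sum>i<n. \<Sum>j<n. M i j * (Im (v i) * Re (v j)))"
    by (subst sum.swap) (intro sum.cong refl, simp add: sym mult.commute)
  then show "Im (\<Sum>i<n. \<Sum>j<n. of_real (M i j) * cnj (v i) * v j)
      = Im (of_real (quad n M (\<lambda>i. Re (v i)) + quad n M (\<lambda>i. Im (v i))))"
    by (simp add: sum_subtractf algebra_simps)
qed

text \<open>The generating function is \<open>det (I + Z M)\<close>. If \<open>(I + Z M) v = 0\<close> and \<open>u = M v\<close>, then \<open>v = - Z u\<close>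
and the real number \<open>v\<^sup>* M v\<close> equals \<open>- (\<Sum>r. z r * |u r|\<^sup>2)\<close>. Multiplying by \<open>\<omega>\<close> and taking
imaginary parts, the left side is nonnegative and every summand on the right is nonpositive, so
\<open>z r = 0\<close> or \<open>u r = 0\<close> for every \<open>r\<close>;
either way \<open>v r = 0\<close>. The sign hypothesis holds for every \<open>M\<close> when \<open>\<omega> = 1\<close>, and for
positive semidefinite \<open>M\<close> when \<open>\<omega>\<close> lies in the upper half plane.\<close>

lemma nonvanishing_pminor:
  fixes M :: "nat \<Rightarrow> nat \<Rightarrow> real"
  assumes sym: "\<And>i j. i < n \<Longrightarrow> j < n \<Longrightarrow> M i j = M j i"
    and psd: "\<And>v. Im \<omega> * quad n M v \<ge> 0"
  shows "nonvanishing n \<omega> (\<lambda>T. of_real (pminor M T))"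
  unfolding nonvanishing_def
proof (intro allI impI notI)
  fix z assume z: "\<forall>i<n. z i = 0 \<or> Im (\<omega> * z i) > 0"
    and zero: "genfun n (\<lambda>T. of_real (pminor M T)) z = 0"
  let ?N = "\<lambda>i j. (if i = j then 1 else 0) + z i * of_real (M i j)"
  have "pminor ?N {..<n} = (\<Sum>T\<in>Pow {..<n}. pminor (\<lambda>i j. z i * of_real (M i j)) T)"
    by (subst pminor_add_diag) simp_all
  also have "\<dots> = genfun n (\<lambda>T. of_real (pminor M T)) z"
    unfolding genfun_def
    by (intro sum.cong refl)
       (simp add: pminor_row_scale pminor_hom[of "of_real :: real \<Rightarrow> complex"] mult.commute)
  finally have "pminor ?N {..<n} = 0" using zero by simp
  then obtain v i0 where i0: "i0 < n" "v i0 \<noteq> 0"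
    and ker: "\<And>r. r < n \<Longrightarrow> (\<Sum>j<n. ?N r j * v j) = 0"
    by (rule det_zero_kernel) blast
  define u where "u r = (\<Sum>j<n. of_real (M r j) * v j)" for r
  have v: "v r = - z r * u r" if "r < n" for r
  proof -
    have "(\<Sum>j<n. ?N r j * v j) = (\<Sum>j<n. (if r = j then v j else 0) + z r * (of_real (M r j) * v j))"
      by (rule sum.cong) (auto simp: algebra_simps)
    also have "\<dots> = v r + z r * u r"
      using that by (simp add: sum.distrib u_def sum_distrib_left)
    finally show ?thesis using ker[OF that] by (simp add: add_eq_0_iff)
  qed
  define q where "q = quad n M (\<lambda>i. Re (v i)) + quad n M (\<lambda>i. Im (v i))"
  have "of_real q = (\<Sum>r<n. cnj (v r) * u r)"
    unfolding q_def using hermitian_form_of_real_symmetric[of n M v] sym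
    by (simp add: u_def sum_distrib_left algebra_simps)
  then have "of_real q = cnj (\<Sum>r<n. cnj (v r) * u r)"
    by (metis complex_cnj_complex_of_real)
  also have "\<dots> = (\<Sum>r<n. - (z r * of_real ((cmod (u r))\<^sup>2)))"
    unfolding complex_norm_square by (simp add: v algebra_simps)
  finally have q: "\<omega> * of_real q = - (\<Sum>r<n. \<omega> * z r * of_real ((cmod (u r))\<^sup>2))"
    by (simp add: sum_negf sum_distrib_left algebra_simps)
  have "Im \<omega> * q = - (\<Sum>r<n. Im (\<omega> * z r) * (cmod (u r))\<^sup>2)"
    using arg_cong[OF q, of Im] by (simp only: Im_sum uminus_complex.sel) simp
  moreover have "Im \<omega> * q \<ge> 0" unfolding q_def using psd by (simp add: distrib_left)
  ultimately have le: "(\<Sum>r<n. Im (\<omega> * z r) * (cmod (u r))\<^sup>2) \<le> 0" by simp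
  have nonneg: "Im (\<omega> * z r) * (cmod (u r))\<^sup>2 \<ge> 0" if "r < n" for r
    using z that by (metis mult_nonneg_nonneg less_imp_le mult_zero_right order_refl zero_complex.sel(2) zero_le_power2)
  have "Im (\<omega> * z i0) * (cmod (u i0))\<^sup>2 = 0"
    using sum_nonneg_0[of "{..<n}" "\<lambda>r. Im (\<omega> * z r) * (cmod (u r))\<^sup>2" i0] le nonneg i0
      sum_nonneg[of "{..<n}" "\<lambda>r. Im (\<omega> * z r) * (cmod (u r))\<^sup>2"] by force
  then have "z i0 = 0 \<or> u i0 = 0" using z i0 by force
  then show False using v[OF i0(1)] i0(2) by auto
qed

lemma quad_add: "quad n M (\<lambda>i. v i + t * w i)
  = quad n M v + t * ((\<Sum>i<n. \<Sum>j<n. M i j * v i * w j) + (\<Sum>i<n. \<Sum>j<n. M i j * w i * v j))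
    + t\<^sup>2 * quad n M w"
  by (simp add: quad_def sum.distrib sum_distrib_left algebra_simps power2_eq_square)

lemma quad_shift: "quad n (\<lambda>i j. (if i = j then x else 0) + M i j) v
   = x * (\<Sum>i<n. (v i)\<^sup>2) + quad n M v"
proof -
  have "quad n (\<lambda>i j. (if i = j then x else 0) + M i j) v
     = (\<Sum>i<n. \<Sum>j<n. (if i = j then x * (v i)\<^sup>2 else 0) + M i j * v i * v j)"
    unfolding quad_def
    by (intro sum.cong refl) (auto simp: algebra_simps power2_eq_square)
  then show ?thesis by (simp add: quad_def sum.distrib sum_distrib_left)
qed

lemma quad_le_sum_squares:
  obtains B where "B > 0" "\<And>v. quad n M v \<le> B * (\<Sum>i<n. (v i)\<^sup>2)"
proof
  let ?B = "1 + (\<Sum>i<n. \<Sum>j<n. \<bar>M i j\<bar>)"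
  show "?B > 0" by (intro add_pos_nonneg sum_nonneg) auto
  fix v :: "nat \<Rightarrow> real"
  let ?N = "\<Sum>i<n. (v i)\<^sup>2"
  have N: "?N \<ge> 0" by (intro sum_nonneg) auto
  have "M i j * v i * v j \<le> \<bar>M i j\<bar> * ?N" if "i < n" "j < n" for i j
  proof -
    have "(v i)\<^sup>2 \<le> ?N" "(v j)\<^sup>2 \<le> ?N"
      using that by (auto intro!: member_le_sum)
    moreover have "2 * \<bar>v i * v j\<bar> \<le> (v i)\<^sup>2 + (v j)\<^sup>2"
      using sum_squares_bound[of "\<bar>v i\<bar>" "\<bar>v j\<bar>"] by (simp add: abs_mult)
    ultimately have "\<bar>v i * v j\<bar> \<le> ?N" by linarith
    then have "\<bar>M i j\<bar> * \<bar>v i * v j\<bar> \<le> \<bar>M i j\<bar> * ?N" by (intro mult_left_mono) auto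
    then show ?thesis by (metis abs_le_D1 abs_mult mult.assoc)
  qed
  then have "quad n M v \<le> (\<Sum>i<n. \<Sum>j<n. \<bar>M i j\<bar> * ?N)"
    unfolding quad_def by (intro sum_mono) auto
  also have "\<dots> = (?B - 1) * ?N" by (simp only: sum_distrib_right[symmetric]) simp
  finally show "quad n M v \<le> ?B * ?N" using N by (simp add: algebra_simps)
qed

lemma pminor_nonzero_bounded_below:
  fixes M :: "nat \<Rightarrow> nat \<Rightarrow> real"
  assumes "pminor M {..<n} \<noteq> 0"
  obtains C where "C > 0"
    "\<And>v. (\<Sum>i<n. (v i)\<^sup>2) \<le> C * (\<Sum>r<n. (\<Sum>j<n. M r j * v j)\<^sup>2)"
proof -
  let ?A = "mat n n (\<lambda>(i, j). M i j)"
  have "det ?A = pminor (\<lambda>i j. ?A $$ (i, j)) {..<n}" by (rule det_eq_pminor) simp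
  also have "\<dots> = pminor M {..<n}" by (rule pminor_cong) auto
  finally have "det ?A \<noteq> 0" using assms by simp
  then have "?A \<in> Units (ring_mat TYPE(real) n ())" by (intro det_non_zero_imp_unit) auto
  then obtain Q where Q: "Q \<in> carrier_mat n n" "Q * ?A = 1\<^sub>m n"
    by (auto simp: Units_def ring_mat_def)
  let ?C = "1 + (\<Sum>i<n. \<Sum>r<n. (Q $$ (i, r))\<^sup>2)"
  show ?thesis
  proof (rule that)
    show "?C > 0" by (intro add_pos_nonneg sum_nonneg) auto
    fix v :: "nat \<Rightarrow> real"
    define w where "w r = (\<Sum>j<n. M r j * v j)" for r
    have W: "(\<Sum>r<n. (w r)\<^sup>2) \<ge> 0" by (intro sum_nonneg) auto
    have v: "v i = (\<Sum>r<n. Q $$ (i, r) * w r)" if i: "i < n" for i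
    proof -
      have "(\<Sum>r<n. Q $$ (i, r) * w r) = (\<Sum>j<n. (\<Sum>r<n. Q $$ (i, r) * M r j) * v j)"
        unfolding w_def sum_distrib_left sum_distrib_right
        by (subst sum.swap) (simp add: algebra_simps)
      also have "\<dots> = (\<Sum>j<n. (Q * ?A) $$ (i, j) * v j)"
        using Q(1) i by (intro sum.cong refl) (simp add: scalar_prod_def atLeast0LessThan)
      also have "\<dots> = (\<Sum>j<n. if j = i then v j else 0)"
        unfolding Q(2) using i by (intro sum.cong refl) auto
      finally show ?thesis using i by simp
    qed
    have "(\<Sum>i<n. (v i)\<^sup>2) \<le> (\<Sum>i<n. (\<Sum>r<n. (Q $$ (i, r))\<^sup>2) * (\<Sum>r<n. (w r)\<^sup>2))"
      by (intro sum_mono) (use v Cauchy_Schwarz_ineq_sum in auto)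
    also have "\<dots> = (?C - 1) * (\<Sum>r<n. (w r)\<^sup>2)"
      by (simp only: sum_distrib_right[symmetric]) simp
    finally show "(\<Sum>i<n. (v i)\<^sup>2) \<le> ?C * (\<Sum>r<n. (\<Sum>j<n. M r j * v j)\<^sup>2)"
      using W by (simp add: w_def algebra_simps)
  qed
qed

text \<open>Take for \<open>\<mu>\<close> the least number with \<open>P = \<mu> I - M\<close> positive semidefinite. If \<open>P\<close> were
nonsingular, then \<open>|v|\<^sup>2 \<le> C |P v|\<^sup>2\<close>, and evaluating the form at \<open>v - P v / D\<close>, where \<open>D\<close> bounds
the form of \<open>P\<close>, gives \<open>v\<^sup>T P v \<ge> |P v|\<^sup>2 / D \<ge> |v|\<^sup>2 / (C D)\<close>. So \<open>\<mu>\<close> could be decreased.\<close>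

lemma symmetric_max_eigenvalue:
  fixes M :: "nat \<Rightarrow> nat \<Rightarrow> real"
  assumes n: "n \<ge> 1" and sym: "\<And>i j. i < n \<Longrightarrow> j < n \<Longrightarrow> M i j = M j i"
  obtains \<mu> where "pminor (\<lambda>i j. (if i = j then \<mu> else 0) + - M i j) {..<n} = 0"
    "\<And>v. quad n M v \<le> \<mu> * (\<Sum>i<n. (v i)\<^sup>2)"
proof -
  define Y where "Y = {y. \<forall>v. quad n M v \<le> y * (\<Sum>i<n. (v i)\<^sup>2)}"
  obtain B where "B > 0" "\<And>v. quad n M v \<le> B * (\<Sum>i<n. (v i)\<^sup>2)"
    using quad_le_sum_squares by blast
  then have ne: "Y \<noteq> {}" by (auto simp: Y_def)
  have "M 0 0 \<le> y" if "y \<in> Y" for y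
  proof -
    let ?e = "\<lambda>i. if i = 0 then 1 else 0 :: real"
    have e: "(\<Sum>i<n. f i * ?e i) = f 0" for f
      using n by (simp add: if_distrib[of "(*) _"] cong: if_cong)
    have "quad n M ?e = (\<Sum>i<n. (\<Sum>j<n. M i j * ?e j) * ?e i)"
      by (simp add: quad_def sum_distrib_left sum_distrib_right algebra_simps)
    also have "\<dots> = M 0 0" by (simp only: e)
    finally have "quad n M ?e = M 0 0" .
    moreover have "(\<Sum>i<n. (?e i)\<^sup>2) = 1"
      using e[of ?e] by (simp add: power2_eq_square)
    ultimately show ?thesis using that by (auto simp: Y_def dest: spec[of _ ?e])
  qed
  then have bdd: "bdd_below Y" by (rule bdd_belowI)
  define \<mu> where "\<mu> = Inf Y"
  have \<mu>: "quad n M v \<le> \<mu> * (\<Sum>i<n. (v i)\<^sup>2)" for v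
  proof (cases "(\<Sum>i<n. (v i)\<^sup>2) = 0")
    case True
    obtain y where "y \<in> Y" using ne by blast
    then have "quad n M v \<le> y * (\<Sum>i<n. (v i)\<^sup>2)" unfolding Y_def by blast
    then show ?thesis using True by simp
  next
    case False
    then have pos: "(\<Sum>i<n. (v i)\<^sup>2) > 0" by (simp add: less_le sum_nonneg)
    have "quad n M v / (\<Sum>i<n. (v i)\<^sup>2) \<le> \<mu>"
      unfolding \<mu>_def by (rule cInf_greatest[OF ne]) (use pos in \<open>auto simp: Y_def field_simps\<close>)
    then show ?thesis using pos by (simp add: field_simps)
  qed
  define P where "P i j = (if i = j then \<mu> else 0) + - M i j" for i j
  have quadP: "quad n P v = \<mu> * (\<Sum>i<n. (v i)\<^sup>2) - quad n M v" for v
    unfolding P_def quad_shift by (simp add: quad_def sum_negf)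
  have "pminor P {..<n} = 0"
  proof (rule ccontr)
    assume "pminor P {..<n} \<noteq> 0"
    then obtain C where C: "C > 0"
      "\<And>v. (\<Sum>i<n. (v i)\<^sup>2) \<le> C * (\<Sum>r<n. (\<Sum>j<n. P r j * v j)\<^sup>2)"
      by (rule pminor_nonzero_bounded_below) blast
    obtain D where D: "D > 0" "\<And>v. quad n P v \<le> D * (\<Sum>i<n. (v i)\<^sup>2)"
      using quad_le_sum_squares by blast
    have "(\<Sum>i<n. (v i)\<^sup>2) / (C * D) \<le> quad n P v" for v
    proof -
      define w where "w r = (\<Sum>j<n. P r j * v j)" for r
      let ?W = "\<Sum>r<n. (w r)\<^sup>2"
      have 1: "(\<Sum>i<n. \<Sum>j<n. P i j * w i * v j) = ?W"
        by (simp add: w_def power2_eq_square sum_distrib_left algebra_simps)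
      have 2: "(\<Sum>i<n. \<Sum>j<n. P i j * v i * w j) = ?W"
        unfolding 1[symmetric] by (subst sum.swap) (auto intro!: sum.cong simp: P_def sym)
      have "0 \<le> quad n P (\<lambda>i. v i + (- 1 / D) * w i)"
        unfolding quadP using \<mu> by simp
      also have "\<dots> = quad n P v - 2 / D * ?W + (1 / D)\<^sup>2 * quad n P w"
        unfolding quad_add 1 2 by simp
      also have "\<dots> \<le> quad n P v - 2 / D * ?W + (1 / D)\<^sup>2 * (D * ?W)"
        using D(2)[of w] by (intro add_left_mono mult_left_mono) auto
      also have "\<dots> = quad n P v - ?W / D"
        using D(1) by (simp add: field_simps power2_eq_square)
      finally have "?W / D \<le> quad n P v" by simp
      moreover have "(\<Sum>i<n. (v i)\<^sup>2) / (C * D) \<le> ?W / D"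
        using C(2)[of v] C(1) D(1) by (simp add: w_def field_simps)
      ultimately show ?thesis by linarith
    qed
    then have "\<mu> - 1 / (C * D) \<in> Y"
      by (simp add: Y_def quadP algebra_simps)
    then have "\<mu> \<le> \<mu> - 1 / (C * D)" unfolding \<mu>_def by (intro cInf_lower bdd)
    then show False using C(1) D(1) by (simp add: field_simps)
  qed
  then show ?thesis using that \<mu> unfolding P_def by blast
qed

section \<open>Real-rooted polynomials on an interval\<close>

lemma coeff_1_prod_linear:
  fixes a :: "nat \<Rightarrow> 'a :: comm_ring_1"
  shows "coeff (\<Prod>i<d. [:1, - a i:]) 0 = 1" "coeff (\<Prod>i<d. [:1, - a i:]) 1 = - (\<Sum>i<d. a i)"
proof -
  show 0: "coeff (\<Prod>i<d. [:1, - a i:]) 0 = 1" for d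
    by (induction d) (simp_all add: coeff_mult_0)
  show "coeff (\<Prod>i<d. [:1, - a i:]) 1 = - (\<Sum>i<d. a i)"
  proof (induction d)
    case (Suc d)
    have "coeff (p * [:1, - c:]) (Suc 0) = coeff p (Suc 0) - c * coeff p 0" for p :: "'a poly" and c
      by (simp add: mult.commute[of p])
    then show ?case using Suc 0[of d] by simp
  qed simp
qed

text \<open>The \<open>a i\<close> are the reciprocals of the roots, with multiplicity.\<close>

lemma real_rooted_factorization:
  fixes q :: "real poly"
  assumes real: "\<And>z. poly (map_poly of_real q) (z :: complex) = 0 \<Longrightarrow> Im z = 0"
    and q0: "poly q 0 \<noteq> 0"
  shows "\<exists>(d::nat) a. q = Polynomial.smult (poly q 0) (\<Prod>i<d. [:1, - a i:])
    \<and> (\<forall>i<d. a i \<noteq> 0 \<and> poly q (1 / a i) = 0)"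
proof -
  let ?c = "map_poly of_real q :: complex poly"
  obtain root where root: "Polynomial.smult (lead_coeff ?c) (\<Prod>i<degree ?c. [:- root i, 1:]) = ?c"
    by (rule complex_poly_decompose')
  have ev: "poly ?c (of_real x) = of_real (poly q x)" for x
    by (induction q) (auto simp: map_poly_pCons)
  have "?c \<noteq> 0" using q0 ev[of 0] by auto
  have c0: "poly ?c 0 \<noteq> 0" using q0 ev[of 0] by simp
  have rt: "poly ?c (root i) = 0" if "i < degree ?c" for i
    by (subst root[symmetric]) (use that in \<open>auto simp: poly_prod intro!: prod_zero\<close>)
  define r where "r i = Re (root i)" for i
  have r: "root i = of_real (r i)" if "i < degree ?c" for i
    using real[OF rt[OF that]] by (simp add: r_def complex_eq_iff)
  have r0: "r i \<noteq> 0" "poly q (r i) = 0" if "i < degree ?c" for i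
    using rt[OF that] r[OF that] c0 ev[of "r i"] by auto
  have eval: "poly ?c z = poly ?c 0 * (\<Prod>i<degree ?c. 1 - z / root i)" for z
  proof -
    have "poly ?c z = lead_coeff ?c * (\<Prod>i<degree ?c. - root i) * (\<Prod>i<degree ?c. 1 - z / root i)"
    proof -
      have "poly ?c z = lead_coeff ?c * (\<Prod>i<degree ?c. z - root i)"
        by (subst root[symmetric]) (simp add: poly_prod)
      also have "(\<Prod>i<degree ?c. z - root i) = (\<Prod>i<degree ?c. - root i * (1 - z / root i))"
        by (rule prod.cong) (use r r0 in \<open>auto simp: field_simps\<close>)
      finally show ?thesis by (simp only: prod.distrib mult.assoc)
    qed
    moreover have "poly ?c 0 = lead_coeff ?c * (\<Prod>i<degree ?c. - root i)"
      by (subst (1) root[symmetric]) (simp add: poly_prod)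
    ultimately show ?thesis by simp
  qed
  have "poly q x = poly (Polynomial.smult (poly q 0) (\<Prod>i<degree ?c. [:1, - (1 / r i):])) x" for x
  proof -
    have "complex_of_real (poly q x) = of_real (poly q 0) * (\<Prod>i<degree ?c. 1 - of_real x / root i)"
      using eval[of "of_real x"] ev[of x] ev[of 0] by simp
    also have "\<dots> = of_real (poly q 0 * (\<Prod>i<degree ?c. 1 - x / r i))"
      by (simp add: r)
    finally show ?thesis by (simp only: of_real_eq_iff) (simp add: poly_prod)
  qed
  then have "q = Polynomial.smult (poly q 0) (\<Prod>i<degree ?c. [:1, - (1 / r i):])"
    by (intro poly_eq_poly_eq_iff[THEN iffD1] ext)
  moreover have "1 / r i \<noteq> 0 \<and> poly q (1 / (1 / r i)) = 0" if "i < degree ?c" for i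
    using r0[OF that] by simp
  ultimately show ?thesis
    by (intro exI[of _ "degree ?c"] exI[of _ "\<lambda>i. 1 / r i"]) auto
qed

text \<open>Both parts come from the factorization \<open>q s = q 0 * (\<Prod>i. 1 - a i * s)\<close> with real \<open>a i\<close> and all
factors positive on \<open>[0, 1]\<close>. The first is the concavity of \<open>ln q\<close>. For the second, the linear
coefficient is \<open>- q 0 * (\<Sum>i. a i)\<close>, and \<open>1 - a i \<le> exp (- a i)\<close> bounds the product at \<open>s = 1\<close>
by \<open>exp 0\<close>.\<close>

lemma real_rooted_on_interval:
  fixes q :: "real poly"
  assumes real: "\<And>z. poly (map_poly of_real q) (z :: complex) = 0 \<Longrightarrow> Im z = 0"
    and pos: "\<And>s. 0 \<le> s \<Longrightarrow> s \<le> 1 \<Longrightarrow> poly q s > 0"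
  shows "0 \<le> s \<Longrightarrow> s \<le> 1 \<Longrightarrow> min (poly q 0) (poly q 1) \<le> poly q s"
    and "coeff q 1 = 0 \<Longrightarrow> poly q 1 \<le> poly q 0"
proof -
  have q0: "poly q 0 > 0" using pos[of 0] by simp
  have "poly q 0 \<noteq> 0" using q0 by simp
  with real have "\<exists>(d::nat) a. q = Polynomial.smult (poly q 0) (\<Prod>i<d. [:1, - a i:])
    \<and> (\<forall>i<d. a i \<noteq> 0 \<and> poly q (1 / a i) = 0)"
    by (rule real_rooted_factorization)
  then obtain d :: nat and a where q: "q = Polynomial.smult (poly q 0) (\<Prod>i<d. [:1, - a i:])"
    and a: "\<And>i. i < d \<Longrightarrow> a i \<noteq> 0 \<and> poly q (1 / a i) = 0"
    by (elim exE conjE) simp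
  have ev: "poly q s = poly q 0 * (\<Prod>i<d. 1 - a i * s)" for s
    by (subst (1) q) (simp add: poly_prod algebra_simps)
  have a1: "a i < 1" if "i < d" for i
  proof (rule ccontr)
    assume "\<not> a i < 1"
    then have "poly q (1 / a i) > 0" by (intro pos) auto
    then show False using a[OF that] by simp
  qed
  have as: "1 - a i * s > 0" if "i < d" "0 \<le> s" "s \<le> 1" for i s
  proof -
    have "a i * s < 1"
    proof (cases "a i \<le> 0")
      case True
      then show ?thesis using that mult_nonpos_nonneg[of "a i" s] by linarith
    next
      case False
      then have "a i * s \<le> a i * 1" using that by (intro mult_left_mono) auto
      then show ?thesis using a1[OF that(1)] by linarith
    qed
    then show ?thesis by simp
  qed
  {
    assume s: "0 \<le> s" "s \<le> 1"
    \<comment> \<open>Concavity of the logarithm between \<open>1\<close> and \<open>x = 1 - a i\<close>, obtained from \<open>ln t \<le> t - 1\<close> at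
      \<open>t = x / A\<close> and \<open>t = 1 / A\<close> with \<open>A\<close> the weighted mean.\<close>
    have ln: "s * ln (1 - a i) \<le> ln (1 - a i * s)" if i: "i < d" for i
    proof -
      define x where "x = 1 - a i"
      define A where "A = 1 - a i * s"
      have x: "x > 0" and A: "A > 0" using a1[OF i] as[OF i s] by (auto simp: x_def A_def)
      have eq: "A = (1 - s) + s * x" by (simp add: A_def x_def algebra_simps)
      have "ln (x / A) \<le> x / A - 1" "ln (1 / A) \<le> 1 / A - 1"
        using x A by (auto intro!: ln_le_minus_one)
      then have "s * ln (x / A) + (1 - s) * ln (1 / A) \<le> s * (x / A - 1) + (1 - s) * (1 / A - 1)"
        using s by (intro add_mono mult_left_mono) auto
      also have "\<dots> = (s * x + (1 - s)) / A - 1" by (simp add: add_divide_distrib diff_divide_distrib algebra_simps)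
      also have "\<dots> = 0" using A eq by simp
      finally have "s * (ln x - ln A) + (1 - s) * (- ln A) \<le> 0"
        using x A by (simp add: ln_div)
      then show ?thesis by (simp add: x_def A_def algebra_simps)
    qed
    let ?P = "\<lambda>s. \<Prod>i<d. 1 - a i * s"
    have P: "?P s > 0" "?P 1 > 0" using as a1 s by (auto intro!: prod_pos)
    have ne: "1 - a i * s \<noteq> 0" "1 - a i * 1 \<noteq> 0" if "i \<in> {..<d}" for i
      using as[of i s] as[of i 1] s that by auto
    have "s * ln (?P 1) = (\<Sum>i<d. s * ln (1 - a i * 1))"
      using ne by (subst ln_prod) (auto simp: sum_distrib_left)
    also have "\<dots> \<le> (\<Sum>i<d. ln (1 - a i * s))" using ln by (intro sum_mono) auto
    also have "\<dots> = ln (?P s)" using ne by (subst ln_prod) auto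
    finally have le: "s * ln (?P 1) \<le> ln (?P s)" .
    have "min 1 (?P 1) \<le> ?P s"
    proof (cases "?P 1 \<ge> 1")
      case True
      then have "0 \<le> ln (?P s)" using le s by (smt (verit) ln_ge_zero mult_nonneg_nonneg)
      then show ?thesis using P by (simp add: ln_ge_zero_iff min.coboundedI1)
    next
      case False
      then have "ln (?P 1) \<le> 0" using P by simp
      then have "1 * ln (?P 1) \<le> s * ln (?P 1)" using s by (intro mult_right_mono_neg) auto
      then have "ln (?P 1) \<le> ln (?P s)" using le by simp
      then have "?P 1 \<le> ?P s" using P by simp
      then show ?thesis by (rule min.coboundedI2)
    qed
    then have "poly q 0 * min 1 (?P 1) \<le> poly q 0 * ?P s" using q0 by (intro mult_left_mono) auto
    moreover have "poly q 0 * min 1 (?P 1) = min (poly q 0) (poly q 1)"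
      using q0 by (simp add: ev[of 1] min_mult_distrib_left)
    ultimately show "min (poly q 0) (poly q 1) \<le> poly q s" using ev[of s] by simp
  }
  {
    assume "coeff q 1 = 0"
    then have "poly q 0 * (\<Sum>i<d. a i) = 0"
      using coeff_1_prod_linear(2)[of a d] by (subst (asm) q) simp
    then have sum: "(\<Sum>i<d. a i) = 0" using q0 by simp
    have "(\<Prod>i<d. 1 - a i * 1) \<le> (\<Prod>i<d. exp (- a i))"
    proof (intro prod_mono conjI)
      fix i assume i: "i \<in> {..<d}"
      show "0 \<le> 1 - a i * 1" using a1 i by (simp add: less_imp_le)
      show "1 - a i * 1 \<le> exp (- a i)" using exp_ge_add_one_self[of "- a i"] by simp
    qed
    also have "\<dots> = 1" by (simp add: sum exp_sum[symmetric] sum_negf)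
    finally show "poly q 1 \<le> poly q 0" using q0 ev[of 1] by simp
  }
qed

section \<open>A pencil joining the two characteristic polynomials\<close>

text \<open>The parameter \<open>s\<close> switches on the set function \<open>c\<close>. With \<open>b\<close> from one matrix and \<open>c\<close> from the
others, \<open>s = 0\<close> gives the characteristic polynomial of the one matrix and \<open>s = 1\<close> the rescaled
mixed determinantal polynomial, both as functions of \<open>y\<close>.\<close>

definition pencil :: "nat \<Rightarrow> (nat set \<Rightarrow> 'a) \<Rightarrow> (nat set \<Rightarrow> 'a) \<Rightarrow> 'a \<Rightarrow> 'a \<Rightarrow> 'a :: comm_ring_1" where
  "pencil n b c y s = conv (conv (pow_card y) b) (\<lambda>T. s ^ card T * c T) {..<n}"

definition pencil_poly :: "nat \<Rightarrow> (nat set \<Rightarrow> 'a) \<Rightarrow> (nat set \<Rightarrow> 'a) \<Rightarrow> 'a \<Rightarrow> 'a :: comm_ring_1 poly" where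
  "pencil_poly n b c y =
     (\<Sum>T\<in>Pow {..<n}. monom (conv (pow_card y) b ({..<n} - T) * c T) (card T))"

lemma poly_pencil_poly: "poly (pencil_poly n b c y) s = pencil n b c y s"
  unfolding pencil_poly_def pencil_def conv_commute[of "conv (pow_card y) b"]
    conv_def[of "\<lambda>T. s ^ card T * c T"]
  by (simp add: poly_sum poly_monom mult_ac)

lemma of_real_conv:
  "(of_real (conv a b T) :: 'a :: {comm_ring_1, real_algebra_1})
    = conv (\<lambda>T. of_real (a T)) (\<lambda>T. of_real (b T)) T"
  by (simp add: conv_def)

lemma of_real_pow_card: "(\<lambda>T. of_real (pow_card x T)) = pow_card (of_real x)"
  by (simp add: pow_card_def fun_eq_iff)

text \<open>The same polynomial evaluated at complex \<open>s\<close> is a pencil over the complex numbers, to which the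
nonvanishing results apply.\<close>

lemma poly_complex_pencil_poly:
  "poly (map_poly of_real (pencil_poly n b c y)) (z :: complex)
    = pencil n (\<lambda>T. of_real (b T)) (\<lambda>T. of_real (c T)) (of_real y) z"
proof -
  have "map_poly complex_of_real (sum f A) = (\<Sum>x\<in>A. map_poly of_real (f x))" for f and A :: "nat set set"
    by (induction A rule: infinite_finite_induct) (simp_all add: of_real_hom.map_poly_hom_add)
  then have "map_poly complex_of_real (pencil_poly n b c y)
      = pencil_poly n (\<lambda>T. of_real (b T)) (\<lambda>T. of_real (c T)) (of_real y)"
    unfolding pencil_poly_def
    by (simp add: map_poly_monom of_real_conv of_real_pow_card[symmetric])
  then show ?thesis by (simp add: poly_pencil_poly)
qed

text \<open>This is where zero diagonals enter: if \<open>c\<close> is a convolution of principal minors of matrices,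
then \<open>c {i}\<close> is the sum of their diagonal entries in row \<open>i\<close>.\<close>

lemma coeff_1_pencil_poly:
  assumes "\<And>i. i < n \<Longrightarrow> c {i} = 0"
  shows "coeff (pencil_poly n b c y) 1 = 0"
proof -
  have "c T = 0" if "T \<subseteq> {..<n}" "card T = 1" for T
    using that assms by (auto simp: card_1_singleton_iff)
  then show ?thesis
    unfolding pencil_poly_def coeff_sum
    by (intro sum.neutral) (auto simp: coeff_monom)
qed

lemma pencil_0:
  assumes "c {} = 1"
  shows "pencil n b c y 0 = conv (pow_card y) b {..<n}"
proof -
  have "0 ^ card U * c U = conv_unit U" if "U \<subseteq> {..<n}" for U
  proof (cases "U = {}")
    case False
    then have "card U > 0" using that finite_subset by (auto simp: card_gt_0_iff)
    then show ?thesis using False by (simp add: conv_unit_def zero_power)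
  qed (simp add: assms conv_unit_def)
  then have "pencil n b c y 0 = conv (conv_unit) (conv (pow_card y) b) {..<n}"
    unfolding pencil_def conv_commute[of "conv (pow_card y) b"]
    by (intro conv_cong) auto
  then show ?thesis by (simp add: conv_unit_left)
qed

lemma pencil_expand:
  "pencil n b c y s = (\<Sum>T\<in>Pow {..<n}. conv b (\<lambda>T. s ^ card T * c T) T * y ^ (n - card T))"
proof -
  have "pencil n b c y s = conv (conv b (\<lambda>T. s ^ card T * c T)) (pow_card y) {..<n}"
    unfolding pencil_def by (metis conv_assoc conv_commute)
  also have "\<dots> = (\<Sum>T\<in>Pow {..<n}. conv b (\<lambda>T. s ^ card T * c T) T * y ^ (n - card T))"
    unfolding conv_def[of "conv b _"]
    by (intro sum.cong refl) (auto simp: pow_card_def card_Diff_subset finite_subset)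
  finally show ?thesis .
qed

text \<open>Split \<open>y = d + \<mu>\<close> with \<open>d > 0\<close> and absorb \<open>\<mu>\<close> into the matrix: \<open>\<mu> I - M\<close> is positive
semidefinite, so its principal minors have a generating function that does not vanish on the
half plane of \<open>s\<close>, like that of the rotated \<open>c\<close>. The pencil is \<open>d ^ n\<close> times the generating
function of their convolution at the point with all coordinates \<open>1 / d\<close>, and a positive real
number lies in the half plane of \<open>s\<close>.\<close>

lemma pencil_nonzero:
  fixes M :: "nat \<Rightarrow> nat \<Rightarrow> real" and c :: "nat set \<Rightarrow> real"
  assumes sym: "\<And>i j. i < n \<Longrightarrow> j < n \<Longrightarrow> M i j = M j i"
    and psd: "\<And>v. quad n M v \<le> \<mu> * (\<Sum>i<n. (v i)\<^sup>2)"
    and c: "nonvanishing n 1 (\<lambda>T. of_real (c T))"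
    and y: "y > \<mu>" and s: "Im s > 0"
  shows "pencil n (\<lambda>T. of_real (pminor (\<lambda>i j. - M i j) T)) (\<lambda>T. of_real (c T)) (of_real y) s \<noteq> 0"
proof -
  let ?b = "\<lambda>T. complex_of_real (pminor (\<lambda>i j. - M i j) T)"
  let ?P = "\<lambda>i j. (if i = j then \<mu> else 0) + - M i j"
  let ?h = "\<lambda>T. complex_of_real (pminor ?P T)"
  let ?c = "\<lambda>T. s ^ card T * complex_of_real (c T)"
  define d where "d = complex_of_real (y - \<mu>)"
  have d: "d \<noteq> 0" using y by (simp add: d_def)
  have "quad n ?P v \<ge> 0" for v
    unfolding quad_shift using psd[of v] by (simp add: quad_def sum_negf)
  then have "nonvanishing n s ?h"
    using s by (intro nonvanishing_pminor) (auto simp: sym)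
  moreover have "nonvanishing n s ?c" by (rule nonvanishing_scale[OF c])
  ultimately have nv: "nonvanishing n s (conv ?h ?c)" by (rule nonvanishing_conv)
  have h: "?h T = conv (pow_card (of_real \<mu>)) ?b T" if "finite T" for T
    unfolding pminor_shift[OF that] of_real_conv of_real_pow_card ..
  have shift: "conv (pow_card (of_real y)) ?b T = conv (pow_card d) ?h T" if T: "finite T" for T
  proof -
    have "conv (pow_card d) ?h T = conv (pow_card d) (conv (pow_card (of_real \<mu>)) ?b) T"
      by (rule conv_cong) (use T h finite_subset in auto)
    also have "\<dots> = conv (conv (pow_card d) (pow_card (of_real \<mu>))) ?b T"
      by (simp add: conv_assoc)
    also have "\<dots> = conv (pow_card (d + of_real \<mu>)) ?b T"
      by (rule conv_cong) (use T in \<open>auto intro!: conv_pow_card intro: finite_subset\<close>)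
    finally show ?thesis by (simp add: d_def)
  qed
  have "pencil n ?b (\<lambda>T. of_real (c T)) (of_real y) s = pencil n ?h (\<lambda>T. of_real (c T)) d s"
    unfolding pencil_def by (rule conv_cong) (use shift finite_subset in blast, simp)
  also have "\<dots> = (\<Sum>T\<in>Pow {..<n}. conv ?h ?c T * d ^ (n - card T))"
    by (rule pencil_expand)
  also have "\<dots> = d ^ n * genfun n (conv ?h ?c) (\<lambda>_. 1 / d)"
  proof -
    have "conv ?h ?c T * d ^ (n - card T) = d ^ n * (conv ?h ?c T * (\<Prod>i\<in>T. 1 / d))"
      if "T \<in> Pow {..<n}" for T
    proof -
      have "card T \<le> n" using that card_mono[of "{..<n}" T] by simp
      then have "d ^ (n - card T) = d ^ n * (1 / d) ^ card T"
        using d by (simp add: power_diff power_one_over)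
      then show ?thesis by simp
    qed
    then show ?thesis unfolding genfun_def sum_distrib_left by (rule sum.cong[OF refl])
  qed
  finally have eq: "pencil n ?b (\<lambda>T. of_real (c T)) (of_real y) s
      = d ^ n * genfun n (conv ?h ?c) (\<lambda>_. 1 / d)" .
  have "s * (1 / d) = s / of_real (y - \<mu>)" by (simp add: d_def)
  then have "Im (s * (1 / d)) = Im s / (y - \<mu>)" by (metis Im_divide_of_real)
  then have "Im (s * (1 / d)) > 0" using s y by simp
  then have "genfun n (conv ?h ?c) (\<lambda>_. 1 / d) \<noteq> 0"
    using nv[unfolded nonvanishing_def, rule_format, of "\<lambda>_. 1 / d"] by auto
  then show ?thesis using eq d by simp
qed

lemma pencil_poly_real_rooted:
  fixes M :: "nat \<Rightarrow> nat \<Rightarrow> real" and c :: "nat set \<Rightarrow> real"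
  assumes sym: "\<And>i j. i < n \<Longrightarrow> j < n \<Longrightarrow> M i j = M j i"
    and psd: "\<And>v. quad n M v \<le> \<mu> * (\<Sum>i<n. (v i)\<^sup>2)"
    and c: "nonvanishing n 1 (\<lambda>T. of_real (c T))"
    and y: "y > \<mu>"
    and zero: "poly (map_poly of_real (pencil_poly n (pminor (\<lambda>i j. - M i j)) c y)) (z :: complex) = 0"
  shows "Im z = 0"
proof -
  let ?p = "map_poly complex_of_real (pencil_poly n (pminor (\<lambda>i j. - M i j)) c y)"
  have pos: "poly ?p w \<noteq> 0" if "Im w > 0" for w
    unfolding poly_complex_pencil_poly
    by (rule pencil_nonzero[where \<mu> = \<mu>]) (use sym psd c y that in auto)
  have "poly ?p (cnj z) = cnj (poly ?p z)"
    by (rule poly_cnj_real[symmetric]) (simp add: coeff_map_poly)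
  then have "poly ?p (cnj z) = 0" using zero by simp
  then show ?thesis using pos[of z] pos[of "cnj z"] zero by force
qed

text \<open>The pencil is \<open>y ^ n\<close> plus terms of lower order in \<open>y\<close> whose coefficients are bounded uniformly for
\<open>s\<close> in \<open>[0, 1]\<close>.\<close>

lemma pencil_positive_at_infinity:
  fixes b c :: "nat set \<Rightarrow> real"
  assumes "b {} = 1" "c {} = 1"
  obtains Y where "\<And>y s. y \<ge> Y \<Longrightarrow> 0 \<le> s \<Longrightarrow> s \<le> 1 \<Longrightarrow> pencil n b c y s > 0"
proof
  define K where "K = (\<Sum>T\<in>Pow {..<n}. conv (\<lambda>T. \<bar>b T\<bar>) (\<lambda>T. \<bar>c T\<bar>) T)"
  have Knn: "conv (\<lambda>T. \<bar>b T\<bar>) (\<lambda>T. \<bar>c T\<bar>) T \<ge> 0" for T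
    unfolding conv_def by (intro sum_nonneg) auto
  then have K: "K \<ge> 0" unfolding K_def by (intro sum_nonneg) auto
  fix y s :: real assume y: "y \<ge> K + 1" and s: "0 \<le> s" "s \<le> 1"
  let ?d = "conv b (\<lambda>T. s ^ card T * c T)"
  have y1: "y \<ge> 1" using y K by simp
  have d: "\<bar>?d T\<bar> \<le> conv (\<lambda>T. \<bar>b T\<bar>) (\<lambda>T. \<bar>c T\<bar>) T" for T
  proof -
    have "\<bar>?d T\<bar> \<le> (\<Sum>U\<in>Pow T. \<bar>b U * (s ^ card (T - U) * c (T - U))\<bar>)"
      unfolding conv_def by (rule sum_abs)
    also have "\<dots> \<le> (\<Sum>U\<in>Pow T. \<bar>b U\<bar> * \<bar>c (T - U)\<bar>)"
    proof (rule sum_mono)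
      fix U
      have "\<bar>s ^ card (T - U)\<bar> * \<bar>c (T - U)\<bar> \<le> 1 * \<bar>c (T - U)\<bar>"
        using s by (intro mult_right_mono) (auto simp: power_abs power_le_one)
      then show "\<bar>b U * (s ^ card (T - U) * c (T - U))\<bar> \<le> \<bar>b U\<bar> * \<bar>c (T - U)\<bar>"
        by (simp add: abs_mult mult_left_mono)
    qed
    finally show ?thesis by (simp add: conv_def)
  qed
  have "y * (y ^ n - pencil n b c y s) \<le> K * y ^ n"
  proof -
    have "pencil n b c y s = ?d {} * y ^ n + (\<Sum>T\<in>Pow {..<n} - {{}}. ?d T * y ^ (n - card T))"
      unfolding pencil_expand by (subst sum.remove[of _ "{}"]) auto
    then have "y * (y ^ n - pencil n b c y s) = (\<Sum>T\<in>Pow {..<n} - {{}}. y * (- ?d T * y ^ (n - card T)))"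
      using assms by (simp add: conv_empty sum_negf sum_distrib_left)
    also have "\<dots> \<le> (\<Sum>T\<in>Pow {..<n} - {{}}. conv (\<lambda>T. \<bar>b T\<bar>) (\<lambda>T. \<bar>c T\<bar>) T * y ^ n)"
    proof (rule sum_mono)
      fix T assume T: "T \<in> Pow {..<n} - {{}}"
      then have cT: "card T \<ge> 1" "card T \<le> n"
        using finite_subset[of T "{..<n}"] card_mono[of "{..<n}" T] by (auto simp: Suc_le_eq card_gt_0_iff)
      have "y * y ^ (n - card T) = y ^ (Suc (n - card T))" by simp
      also have "\<dots> \<le> y ^ n" using cT y1 by (intro power_increasing) auto
      finally have "- ?d T * (y * y ^ (n - card T)) \<le> conv (\<lambda>T. \<bar>b T\<bar>) (\<lambda>T. \<bar>c T\<bar>) T * y ^ n"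
        using d[of T] y1 Knn by (intro mult_mono) auto
      then show "y * (- ?d T * y ^ (n - card T)) \<le> conv (\<lambda>T. \<bar>b T\<bar>) (\<lambda>T. \<bar>c T\<bar>) T * y ^ n"
        by (simp add: algebra_simps)
    qed
    also have "\<dots> \<le> (\<Sum>T\<in>Pow {..<n}. conv (\<lambda>T. \<bar>b T\<bar>) (\<lambda>T. \<bar>c T\<bar>) T * y ^ n)"
      using Knn y1 by (intro sum_mono2) auto
    finally show ?thesis by (simp add: K_def sum_distrib_right)
  qed
  also have "K * y ^ n < y * y ^ n" using y y1 by (intro mult_strict_right_mono) auto
  finally show "pencil n b c y s > 0" using y1 by simp
qed

lemma continuous_pencil: "continuous_on S (\<lambda>p. pencil n b c (fst p) (snd p :: real))"
  unfolding pencil_def conv_def pow_card_def by (intro continuous_intros)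

text \<open>Suppose \<open>Q y 1 > 0\<close> for all \<open>y \<ge> \<mu>\<close>. Log-concavity in \<open>s\<close> then keeps \<open>Q y\<close> positive on all of
\<open>[0, 1]\<close> for \<open>y > \<mu>\<close>. As the derivative in \<open>s\<close> vanishes at \<open>0\<close>, it follows that
\<open>Q y 1 \<le> Q y 0\<close>, and in the limit \<open>y \<rightarrow> \<mu>\<close> that \<open>Q \<mu> 1 \<le> 0\<close>.\<close>

lemma pencil_nonpos_exists:
  fixes n :: nat and M :: "nat \<Rightarrow> nat \<Rightarrow> real" and c :: "nat set \<Rightarrow> real"
  defines "Q \<equiv> pencil n (pminor (\<lambda>i j. - M i j)) c"
  assumes sym: "\<And>i j. i < n \<Longrightarrow> j < n \<Longrightarrow> M i j = M j i"
    and psd: "\<And>v. quad n M v \<le> \<mu> * (\<Sum>i<n. (v i)\<^sup>2)"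
    and c: "nonvanishing n 1 (\<lambda>T. of_real (c T))"
    and c0: "c {} = 1" and c1: "\<And>i. i < n \<Longrightarrow> c {i} = 0"
    and zero: "Q \<mu> 0 = 0" and pos: "\<And>y. y > \<mu> \<Longrightarrow> Q y 0 > 0"
  shows "\<exists>y\<ge>\<mu>. Q y 1 \<le> 0"
proof (rule ccontr)
  assume "\<not> ?thesis"
  then have pos1: "Q y 1 > 0" if "y \<ge> \<mu>" for y using that by force
  have cont: "continuous_on S (\<lambda>p. Q (fst p) (snd p))" for S
    unfolding Q_def by (rule continuous_pencil)
  have cont_y: "continuous_on S (\<lambda>y. Q y s)" for S s
    using continuous_on_compose2[OF cont, of S "\<lambda>y. (y, s)" UNIV]
    by (simp add: continuous_on_Pair)
  define q where "q y = pencil_poly n (pminor (\<lambda>i j. - M i j)) c y" for y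
  have q: "poly (q y) s = Q y s" for y s
    unfolding q_def Q_def by (rule poly_pencil_poly)
  have real: "Im z = 0" if "y > \<mu>" "poly (map_poly of_real (q y)) (z :: complex) = 0" for y z
    using that unfolding q_def by (intro pencil_poly_real_rooted[OF sym psd c]) auto
  have positive: "Q y s > 0" if y: "y > \<mu>" and nz: "\<And>s. 0 \<le> s \<Longrightarrow> s \<le> 1 \<Longrightarrow> Q y s \<noteq> 0"
    and s: "0 \<le> s" "s \<le> 1" for y s
  proof (rule ccontr)
    assume "\<not> Q y s > 0"
    then have "poly (q y) s < 0" using nz[OF s] by (simp add: q)
    moreover have "poly (q y) 0 > 0" using pos[OF y] by (simp add: q)
    ultimately obtain x where "0 < x" "x < s" "poly (q y) x = 0"
      using poly_IVT_neg[of 0 s "q y"] s by (metis less_eq_real_def order_less_asym)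
    then show False using nz[of x] s by (simp add: q)
  qed
  have nz: "Q y s \<noteq> 0" if "y > \<mu>" "0 \<le> s" "s \<le> 1" for y s
  proof
    assume Q0: "Q y s = 0"
    obtain Y where Y: "\<And>y s. y \<ge> Y \<Longrightarrow> 0 \<le> s \<Longrightarrow> s \<le> 1 \<Longrightarrow> Q y s > 0"
      unfolding Q_def by (rule pencil_positive_at_infinity[of "pminor (\<lambda>i j. - M i j)" c n])
        (use c0 in auto)
    define Z where "Z = {p \<in> {y..Y} \<times> {0..1}. Q (fst p) (snd p) = 0}"
    have "closed {p. Q (fst p) (snd p) = 0}"
      by (intro closed_Collect_eq cont continuous_intros)
    then have "compact (({y..Y} \<times> {0..1}) \<inter> {p. Q (fst p) (snd p) = 0})"
      by (intro compact_Int_closed compact_Times) auto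
    also have "({y..Y} \<times> {0..1}) \<inter> {p. Q (fst p) (snd p) = 0} = Z"
      by (auto simp: Z_def)
    finally have "compact Z" .
    moreover have "y < Y" using Y[of y s] Q0 that by force
    then have "(y, s) \<in> Z" using Q0 that by (simp add: Z_def)
    \<comment> \<open>A zero with the largest first coordinate \<open>y1\<close>: all segments above \<open>y1\<close> are free of zeros.\<close>
    ultimately obtain p where p: "p \<in> Z" "\<And>p'. p' \<in> Z \<Longrightarrow> fst p' \<le> fst p"
      using continuous_attains_sup[of Z fst] continuous_on_fst[OF continuous_on_id] by blast
    obtain y1 s1 where p_eq: "p = (y1, s1)" by (cases p)
    have y1: "y1 > \<mu>" "y1 \<le> Y" "y \<le> y1" and s1: "0 \<le> s1" "s1 \<le> 1" and Q1: "Q y1 s1 = 0"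
      using p(1) that(1) by (auto simp: Z_def p_eq)
    have "min (Q y' 0) (Q y' 1) \<le> Q y' s1" if y': "y' > y1" for y'
    proof -
      have "Q y' t \<noteq> 0" if t: "0 \<le> t" "t \<le> 1" for t
      proof (cases "y' \<le> Y")
        case True
        then show ?thesis using p(2)[of "(y', t)"] y' y1 t by (auto simp: Z_def p_eq)
      next
        case False
        then show ?thesis using Y[of y' t] t by simp
      qed
      then have "Q y' t > 0" if "0 \<le> t" "t \<le> 1" for t
        using positive[of y' t] y' y1 that by auto
      then show ?thesis
        using real_rooted_on_interval(1)[of "q y'" s1] real[of y'] y' y1 s1 by (auto simp: q)
    qed
    then have "eventually (\<lambda>y'. min (Q y' 0) (Q y' 1) \<le> Q y' s1) (at_right y1)"
      by (auto simp: eventually_at_filter)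
    moreover have lim: "((\<lambda>y'. Q y' t) \<longlongrightarrow> Q y1 t) (at_right y1)" for t
      using cont_y[of UNIV t] by (auto simp: continuous_on_def intro: tendsto_within_subset)
    ultimately have "min (Q y1 0) (Q y1 1) \<le> Q y1 s1"
      by (intro tendsto_le[OF _ lim tendsto_min[OF lim lim]]) auto
    then show False using Q1 pos[OF y1(1)] pos1[of y1] y1 by auto
  qed
  have "Q y 1 \<le> Q y 0" if y: "y > \<mu>" for y
    using real_rooted_on_interval(2)[of "q y"] real[OF y] positive[OF y nz[OF y]]
      coeff_1_pencil_poly[of n c "pminor (\<lambda>i j. - M i j)" y] c1 by (auto simp: q q_def[symmetric])
  then have "eventually (\<lambda>y. Q y 1 \<le> Q y 0) (at_right \<mu>)"
    by (auto simp: eventually_at_filter)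
  moreover have lim: "((\<lambda>y. Q y t) \<longlongrightarrow> Q \<mu> t) (at_right \<mu>)" for t
    using cont_y[of UNIV t] by (auto simp: continuous_on_def intro: tendsto_within_subset)
  ultimately have "Q \<mu> 1 \<le> Q \<mu> 0"
    by (intro tendsto_le[OF _ lim lim]) auto
  then show False using zero pos1[of \<mu>] by simp
qed

section \<open>Largest roots\<close>

lemma poly_root_ge:
  fixes p :: "real poly"
  assumes "poly p x \<le> 0" "poly p z > 0" "x \<le> z"
  shows "\<exists>r\<ge>x. poly p r = 0"
proof (cases "poly p x = 0")
  case False
  then have "poly p x < 0" "x < z" using assms by (auto simp: less_le)
  then show ?thesis using poly_IVT_pos[of x z p] assms by (meson less_imp_le)
qed auto

lemma lambda_max_ge:
  assumes "p \<noteq> 0" "poly p r = 0"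
  shows "r \<le> lambda_max p"
  unfolding lambda_max_def by (rule Max_ge) (use assms poly_roots_finite in auto)

lemma lambda_max_root:
  assumes "p \<noteq> 0" "poly p r = 0"
  shows "poly p (lambda_max p) = 0"
  using Max_in[of "{x. poly p x = 0}"] assms poly_roots_finite[of p]
  unfolding lambda_max_def by auto

theorem theorem6:
  fixes n k :: nat and A :: "nat \<Rightarrow> real mat"
  assumes "n \<ge> 1" and "k \<ge> 1"
    and "\<And>i. i < k \<Longrightarrow> A i \<in> carrier_mat n n"
    and "\<And>i. i < k \<Longrightarrow> transpose_mat (A i) = A i"
    and "\<And>i j. i < k \<Longrightarrow> j < n \<Longrightarrow> A i $$ (j, j) = 0"
  shows "Max ((\<lambda>i. lambda_max (char_poly (A i))) ` {..<k})
           \<le> real k * lambda_max (mixed_char_poly n k A)"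
proof -
  have sym: "A i $$ (r, c) = A i $$ (c, r)" if "i < k" "r < n" "c < n" for i r c
    using assms(3)[OF that(1)] assms(4)[OF that(1)] that
    by (metis carrier_matD index_transpose_mat(1))
  define b where "b i = pminor (\<lambda>r c. - A i $$ (r, c))" for i
  have nv: "nonvanishing n 1 (\<lambda>T. of_real (b i T))" if "i < k" for i
    unfolding b_def by (rule nonvanishing_pminor) (use sym that in auto)
  have "lambda_max (char_poly (A j)) \<le> real k * lambda_max (mixed_char_poly n k A)"
    if j: "j < k" for j
  proof -
    define M where "M r c = A j $$ (r, c)" for r c
    let ?L = "lambda_max (char_poly (A j))"
    have bj: "b j = pminor (\<lambda>r c. - M r c)" by (simp add: b_def M_def)
    have char: "poly (char_poly (A j)) x = conv (pow_card x) (b j) {..<n}" for x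
      unfolding b_def by (rule poly_char_poly[OF assms(3)[OF j]])
    have monic: "lead_coeff (char_poly (A j)) = 1"
      using degree_monic_char_poly[OF assms(3)[OF j]] by simp
    then have char0: "char_poly (A j) \<noteq> 0" by auto
    obtain \<mu> where \<mu>: "pminor (\<lambda>r c. (if r = c then \<mu> else 0) + - M r c) {..<n} = 0"
      "\<And>v. quad n M v \<le> \<mu> * (\<Sum>i<n. (v i)\<^sup>2)"
      by (rule symmetric_max_eigenvalue[of n M]) (use assms(1) sym j in \<open>auto simp: M_def\<close>)
    have root: "poly (char_poly (A j)) \<mu> = 0"
      using \<mu>(1) pminor_shift[of "{..<n}" \<mu> "\<lambda>r c. - M r c"] by (simp add: char bj)
    then have "\<mu> \<le> ?L" by (rule lambda_max_ge[OF char0])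
    then have psd: "quad n M v \<le> ?L * (\<Sum>i<n. (v i)\<^sup>2)" for v
      using \<mu>(2)[of v] mult_right_mono[of \<mu> ?L "\<Sum>i<n. (v i)\<^sup>2"] by (simp add: sum_nonneg)
    have rootL: "poly (char_poly (A j)) ?L = 0" by (rule lambda_max_root[OF char0 root])
    have pos: "poly (char_poly (A j)) y > 0" if y: "y > ?L" for y
    proof (rule ccontr)
      assume "\<not> ?thesis"
      moreover obtain z where z: "\<And>x. x \<ge> z \<Longrightarrow> poly (char_poly (A j)) x \<ge> 1"
        using poly_pinfty_gt_lc[of "char_poly (A j)"] monic by auto
      have "poly (char_poly (A j)) (max y z) > 0"
        using z[of "max y z"] by linarith
      ultimately obtain r where "r \<ge> y" "poly (char_poly (A j)) r = 0"
        using poly_root_ge[of "char_poly (A j)" y "max y z"] by (meson max.cobounded1 not_less)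
      then show False using lambda_max_ge[OF char0, of r] y by simp
    qed
    \<comment> \<open>The contribution of all matrices but \<open>A j\<close>.\<close>
    define c where "c = conv_list k (b(j := conv_unit))"
    have b0: "b i {} = 1" and b1: "x < n \<Longrightarrow> b i {x} = 0" if "i < k" for i x
      using that assms(5) by (simp_all add: b_def pminor_singleton)
    have c0: "c {} = 1" 
      unfolding c_def conv_list_empty by (rule prod.neutral) (use b0 in \<open>auto simp: conv_unit_def\<close>)
    have "conv_list l (b(j := conv_unit)) {x} = 0" if "l \<le> k" "x < n" for l x
      using that
    proof (induction l)
      case (Suc l)
      then show ?case using b1[of l x] by (auto simp: conv_singleton conv_unit_def)
    qed (simp add: conv_unit_def)
    then have c1: "c {x} = 0" if "x < n" for x using that by (simp add: c_def)
    have ofc: "of_real (conv_list l a T) = conv_list l (\<lambda>i T. complex_of_real (a i T)) T" for l a and T :: "nat set"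
      by (induction l arbitrary: T) (simp_all add: conv_unit_def of_real_conv)
    have nvc: "nonvanishing n 1 (\<lambda>T. of_real (c T))"
    proof -
      have "nonvanishing n 1 (\<lambda>T. of_real ((b(j := conv_unit)) i T))" if "i < k" for i
      proof (cases "i = j")
        case True
        have "(\<lambda>T. of_real (conv_unit T)) = (conv_unit :: nat set \<Rightarrow> complex)"
          by (auto simp: conv_unit_def)
        then show ?thesis using True nonvanishing_conv_unit by simp
      qed (use nv that in auto)
      then show ?thesis unfolding c_def ofc by (rule nonvanishing_conv_list)
    qed
    have Q0: "pencil n (b j) c y 0 = poly (char_poly (A j)) y" for y
      by (simp add: pencil_0[of c, OF c0] char)
    \<comment> \<open>The factor \<open>k\<close> of the theorem: the \<open>k\<close> copies of \<open>x I\<close> add up to \<open>k * x\<close>.\<close>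
    have Q1: "pencil n (b j) c (real k * x) 1 = real k ^ n * poly (mixed_char_poly n k A) x" for x
    proof -
      have "real k ^ n * poly (mixed_char_poly n k A) x = conv (pow_card (real k * x)) (conv_list k b) {..<n}"
        using poly_mixed_char_poly[of k A n x] assms(2,3) by (simp add: b_def[abs_def])
      also have "\<dots> = conv (pow_card (real k * x)) (conv (b j) c) {..<n}"
        unfolding c_def by (intro conv_cong refl conv_list_extract[OF j]) (auto intro: finite_subset)
      finally show ?thesis by (simp add: pencil_def conv_assoc)
    qed
    \<comment> \<open>A nonpositive value of the pencil at \<open>s = 1\<close> to the right of \<open>?L\<close>, and positive values
      further right, enclose a root of the mixed polynomial.\<close>
    have k: "real k > 0" using assms(2) by simp
    have "\<exists>y\<ge>?L. pencil n (b j) c y 1 \<le> 0"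
      unfolding bj
      by (rule pencil_nonpos_exists[where \<mu> = ?L])
         (use psd nvc c0 c1 rootL pos Q0 sym[OF j] in \<open>auto simp: M_def[symmetric] bj[symmetric]\<close>)
    then obtain y where y: "y \<ge> ?L" "pencil n (b j) c y 1 \<le> 0" by blast
    obtain Y where Y: "\<And>y s. y \<ge> Y \<Longrightarrow> 0 \<le> s \<Longrightarrow> s \<le> 1 \<Longrightarrow> pencil n (b j) c y s > 0"
      by (rule pencil_positive_at_infinity[of "b j" c n]) (use b0[OF j] c0 in auto)
    let ?p = "mixed_char_poly n k A"
    have eq: "real k ^ n * poly ?p (x / real k) = pencil n (b j) c x 1" for x
      using Q1[of "x / real k"] k by simp
    have "poly ?p (y / real k) \<le> 0"
      using eq[of y] y(2) k by (metis mult_pos_pos not_le zero_less_power)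
    moreover have pp: "poly ?p (max y Y / real k) > 0"
      using eq[of "max y Y"] Y[of "max y Y" 1] k
      by (metis max.cobounded2 order_refl zero_le_one zero_less_mult_pos zero_less_power)
    moreover have "y / real k \<le> max y Y / real k"
      by (rule divide_right_mono) (use k in auto)
    ultimately obtain r where r: "r \<ge> y / real k" "poly ?p r = 0"
      using poly_root_ge[of ?p "y / real k" "max y Y / real k"] by blast
    have "?p \<noteq> 0" using pp by auto
    then have "r \<le> lambda_max ?p" using r by (intro lambda_max_ge)
    then have "y / real k \<le> lambda_max ?p" using r by simp
    then show ?thesis using y(1) k by (simp add: field_simps)
  qed
  moreover have "{..<k} \<noteq> {}" using assms(2) by (simp add: lessThan_empty_iff)
  ultimately show ?thesis by (subst Max_le_iff) auto
qed

end
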